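(* Let $A$ be a subring of $\mathbb{C}$ and $\mathcal{A}=1+zA[[z]]$. Let $f_1,f_2\in\mathcal{A}$ be (Taylor series at $0$ of) meromorphic functions $f_1=P_1/Q_1$, $f_2=P_2/Q_2$, where $P_1,Q_1,P_2,Q_2\in\mathcal{A}$ are entire functions of order $<1$. Then $f_1\star f_2$ is a meromorphic function, quotient of entire functions of order $<1$, given by $$f_1\star f_2=\frac{(P_1\star P_2)\cdot(Q_1\star Q_2)}{(P_1\star Q_2)\cdot(Q_1\star P_2)}.$$ Its zeros are the products of a zero of $f_1$ and a zero of $f_2$, or of a pole of $f_1$ and a pole of $f_2$, and its poles are the products of a zero of $f_1$ (resp. $f_2$) and a pole of $f_2$ (resp. $f_1$), in the sense of divisors (counted with multiplicity): for every $\xi\in\mathbb{C}\setminus\{0\}$, $$\operatorname{ord}_\xi(f_1\star f_2)=\sum_{\alpha\beta=\xi}\operatorname{ord}_\alpha(f_1)\,\operatorname{ord}_\beta(f_2).$$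
   Context: $\operatorname{ord}_\xi(f)$ is the order of vanishing of the meromorphic function $f$ at $\xi$ (negative at poles); the sum runs over pairs $(\alpha,\beta)$ of nonzero complex numbers with $\alpha\beta=\xi$, and has finitely many nonzero terms. Eñe product: for $n\ge1$, let $Q_n\in\mathbb{Z}[X_1,\dots,X_n,Y_1,\dots,Y_n]$ be the unique polynomial such that in $\mathbb{Z}[x_1,\dots,x_n,y_1,\dots,y_n]$ the $n$-th elementary symmetric polynomial of the $n^2$ products $x_iy_j$ equals $Q_n(e_1(x),\dots,e_n(x),e_1(y),\dots,e_n(y))$, where $e_k$ are the elementary symmetric polynomials (these universal polynomials are unrelated to the denominators $Q_1,Q_2$ above). For $f=1+\sum_{n\ge1}a_nz^n$ and $g=1+\sum_{n\ge1}b_nz^n$ in $\mathcal{A}$, $f\star g=1+\sum_{n\ge1}c_nz^n$ with $c_n=(-1)^nQ_n(a_1,\dots,a_n,b_1,\dots,b_n)$. *)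

theory Defs
  imports
    "HOL-Complex_Analysis.Complex_Analysis"
    "HOL-Complex_Analysis.Meromorphic"
    "HOL-Library.Poly_Mapping"
begin

section \<open>Integer polynomials in several variables\<close>

text \<open>
  A polynomial with integer coefficients in variables indexed by \<open>'v\<close> is a finitely supported
  map from monomials to coefficients, a monomial being a finitely supported map from variables to
  exponents. The ring structure (convolution product) is the one of \<^theory>\<open>HOL-Library.Poly_Mapping\<close>.
\<close>

type_synonym 'v zpoly = "('v \<Rightarrow>\<^sub>0 nat) \<Rightarrow>\<^sub>0 int"

definition zvar :: "'v \<Rightarrow> 'v zpoly" where
  "zvar v = Poly_Mapping.single (Poly_Mapping.single v 1) 1"

definition zpoly_vars :: "'v zpoly \<Rightarrow> 'v set" where
  "zpoly_vars p = (\<Union>m\<in>Poly_Mapping.keys p. Poly_Mapping.keys m)"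

text \<open>Substitution of elements of a commutative ring for the variables.\<close>

definition zpoly_subst :: "('v \<Rightarrow> 'r::comm_ring_1) \<Rightarrow> 'v zpoly \<Rightarrow> 'r" where
  "zpoly_subst \<rho> p =
     (\<Sum>m\<in>Poly_Mapping.keys p. of_int (Poly_Mapping.lookup p m) *
        (\<Prod>v\<in>Poly_Mapping.keys m. \<rho> v ^ Poly_Mapping.lookup m v))"

text \<open>The \<open>k\<close>-th elementary symmetric function of a finite family \<open>(x\<^sub>i)\<close>, \<open>i \<in> I\<close>.\<close>

definition elem_sym :: "nat \<Rightarrow> 'i set \<Rightarrow> ('i \<Rightarrow> 'r::comm_ring_1) \<Rightarrow> 'r" where
  "elem_sym k I x = (\<Sum>S | S \<subseteq> I \<and> card S = k. \<Prod>i\<in>S. x i)"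


section \<open>The e\~ne product\<close>

text \<open>
  In the polynomials \<open>Q\<^sub>n\<close>, the variable \<open>Inl k\<close> is \<open>X\<^sub>k\<close> and \<open>Inr k\<close> is \<open>Y\<^sub>k\<close>. The defining
  identity lives in a polynomial ring of the same type, where \<open>Inl i\<close> is \<open>x\<^sub>i\<close> and \<open>Inr j\<close> is \<open>y\<^sub>j\<close>.
\<close>

definition is_ene_poly :: "nat \<Rightarrow> (nat + nat) zpoly \<Rightarrow> bool" where
  "is_ene_poly n Q \<longleftrightarrow>
     zpoly_vars Q \<subseteq> Inl ` {1..n} \<union> Inr ` {1..n} \<and>
     zpoly_subst
       (case_sum (\<lambda>k. elem_sym k {1..n} (\<lambda>i. zvar (Inl i)))
                 (\<lambda>k. elem_sym k {1..n} (\<lambda>j. zvar (Inr j)))) Q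
     = (elem_sym n ({1..n} \<times> {1..n}) (\<lambda>(i, j). zvar (Inl i) * zvar (Inr j)) :: (nat + nat) zpoly)"

definition ene_poly :: "nat \<Rightarrow> (nat + nat) zpoly" where
  "ene_poly n = (THE Q. is_ene_poly n Q)"

definition ene :: "complex fps \<Rightarrow> complex fps \<Rightarrow> complex fps"  (infixl \<open>\<star>\<close> 70) where
  "f \<star> g = Abs_fps (\<lambda>n. if n = 0 then 1
     else (- 1) ^ n * zpoly_subst (case_sum (fps_nth f) (fps_nth g)) (ene_poly n))"


section \<open>Subrings of the complex numbers and power series with constant term 1\<close>

definition complex_subring :: "complex set \<Rightarrow> bool" where
  "complex_subring A \<longleftrightarrow>
     1 \<in> A \<and> (\<forall>x\<in>A. \<forall>y\<in>A. x - y \<in> A) \<and> (\<forall>x\<in>A. \<forall>y\<in>A. x * y \<in> A)"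

definition one_series :: "complex set \<Rightarrow> complex fps set" where
  "one_series A = {f. fps_nth f 0 = 1 \<and> (\<forall>n. fps_nth f n \<in> A)}"

lemma complex_subring_closed:
  assumes "complex_subring A"
  shows "0 \<in> A" "1 \<in> A" "x \<in> A \<Longrightarrow> - x \<in> A"
    "x \<in> A \<Longrightarrow> y \<in> A \<Longrightarrow> x + y \<in> A" "x \<in> A \<Longrightarrow> y \<in> A \<Longrightarrow> x * y \<in> A"
    "x \<in> A \<Longrightarrow> x ^ n \<in> A" "of_int i \<in> A"
    "(\<And>s. s \<in> S \<Longrightarrow> h s \<in> A) \<Longrightarrow> sum h S \<in> A"
    "(\<And>s. s \<in> S \<Longrightarrow> h s \<in> A) \<Longrightarrow> prod h S \<in> A"
proof -
  show one: "1 \<in> A"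
    using assms by (simp add: complex_subring_def)
  have diff: "\<And>x y. x \<in> A \<Longrightarrow> y \<in> A \<Longrightarrow> x - y \<in> A"
    and mult: "\<And>x y. x \<in> A \<Longrightarrow> y \<in> A \<Longrightarrow> x * y \<in> A"
    using assms by (auto simp: complex_subring_def)
  show zero: "0 \<in> A"
    using diff[OF one one] by simp
  have minus: "\<And>x. x \<in> A \<Longrightarrow> - x \<in> A"
    using diff[OF zero] by simp
  have plus: "\<And>x y. x \<in> A \<Longrightarrow> y \<in> A \<Longrightarrow> x + y \<in> A"
    using diff minus by (metis diff_minus_eq_add)
  show "x \<in> A \<Longrightarrow> - x \<in> A" "x \<in> A \<Longrightarrow> y \<in> A \<Longrightarrow> x + y \<in> A" "x \<in> A \<Longrightarrow> y \<in> A \<Longrightarrow> x * y \<in> A"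
    by (fact minus plus mult)+
  show "x \<in> A \<Longrightarrow> x ^ n \<in> A"
    by (induction n) (auto intro: one mult)
  have nat: "of_nat k \<in> A" for k
    by (induction k) (auto intro: zero one plus)
  show "of_int i \<in> A"
    by (cases i rule: int_cases2) (auto intro: nat minus)
  show "(\<And>s. s \<in> S \<Longrightarrow> h s \<in> A) \<Longrightarrow> sum h S \<in> A"
    by (induction S rule: infinite_finite_induct) (auto intro: zero plus)
  show "(\<And>s. s \<in> S \<Longrightarrow> h s \<in> A) \<Longrightarrow> prod h S \<in> A"
    by (induction S rule: infinite_finite_induct) (auto intro: one mult)
qed

lemma ene_in_one_series:
  assumes A: "complex_subring A" and f: "f \<in> one_series A" and g: "g \<in> one_series A"
  shows "f \<star> g \<in> one_series A"
proof -
  note cl = complex_subring_closed[OF A]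
  have coeff: "case_sum (fps_nth f) (fps_nth g) v \<in> A" for v
    using f g by (cases v) (auto simp: one_series_def)
  have "zpoly_subst (case_sum (fps_nth f) (fps_nth g)) Q \<in> A" for Q
    unfolding zpoly_subst_def by (intro cl coeff)
  then have "(- 1) ^ n * zpoly_subst (case_sum (fps_nth f) (fps_nth g)) (ene_poly n) \<in> A" for n
    by (intro cl)
  then show ?thesis
    using cl(2) by (simp add: one_series_def ene_def)
qed


section \<open>Order of an entire function\<close>

definition max_modulus :: "(complex \<Rightarrow> complex) \<Rightarrow> real \<Rightarrow> real" where
  "max_modulus f r = (SUP z\<in>sphere 0 r. norm (f z))"

text \<open>
  The classical \<open>limsup (log log M(r) / log r)\<close>, as \<open>r \<rightarrow> \<infinity>\<close>. For constant functions the numerator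
  does not depend on \<open>r\<close> (as \<^const>\<open>ln\<close> is total), so the order is \<open>0\<close>, as usual.
\<close>

definition growth_order :: "(complex \<Rightarrow> complex) \<Rightarrow> ereal" where
  "growth_order f = Limsup at_top (\<lambda>r. ereal (ln (ln (max_modulus f r)) / ln r))"

definition entire_of_order_lt_1 :: "complex fps \<Rightarrow> bool" where
  "entire_of_order_lt_1 f \<longleftrightarrow> fps_conv_radius f = \<infinity> \<and> growth_order (eval_fps f) < 1"

end

theory Submission
  imports Defs "HOL-Real_Asymp.Real_Asymp" "Jordan_Normal_Form.Char_Poly"
begin

text \<open>
  If \<open>f = \<Prod>\<^sub>i (1 - u\<^sub>i z)\<close> and \<open>g = \<Prod>\<^sub>j (1 - v\<^sub>j z)\<close>, then \<open>f \<star> g = \<Prod>\<^sub>i\<^sub>,\<^sub>j (1 - u\<^sub>i v\<^sub>j z)\<close>, so the power sums of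
  the \<open>u\<^sub>i v\<^sub>j\<close>, that is, the coefficients of \<open>- z (f \<star> g)'/(f \<star> g)\<close>, are the products of those of
  \<open>f\<close> and \<open>g\<close>. Since every coefficient involves only finitely many coefficients of \<open>f\<close> and \<open>g\<close>,
  this holds for all power series with constant term 1, and it makes \<open>\<star>\<close> distribute over
  multiplication; the quotient formula is a consequence. In particular
  \<open>f \<star> (1 - z / b) = f (z / b)\<close>.

  An entire function \<open>g\<close> of order less than 1 with \<open>g 0 = 1\<close> is the coefficientwise limit of the
  finite products \<open>\<Prod>\<^bsub>\<bar>b\<bar> \<le> r\<^esub> (1 - z / b)\<close> over its zeros: the zero-free cofactor tends to 1 by the
  Borel-Caratheodory inequality. Hence \<open>f \<star> g\<close> is the coefficientwise limit of the products
  \<open>\<Prod>\<^bsub>\<bar>b\<bar> \<le> r\<^esub> f (z / b)\<close>. They are bounded uniformly in \<open>r\<close>, because \<open>\<Sum>\<^sub>b \<bar>b\<bar> powr (- \<rho>)\<close> converges for some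
  \<open>\<rho> < 1\<close>; Cauchy's inequalities bound the coefficients of the limit, hence its order. Near a given
  point the product over the large zeros is close to 1, so the vanishing of \<open>f \<star> g\<close> is that of a
  finite product.
\<close>

section \<open>Integer polynomials as functions\<close>

definition monom_val :: "('v \<Rightarrow> 'r::comm_ring_1) \<Rightarrow> ('v \<Rightarrow>\<^sub>0 nat) \<Rightarrow> 'r" where
  "monom_val \<rho> m = (\<Prod>v\<in>Poly_Mapping.keys m. \<rho> v ^ Poly_Mapping.lookup m v)"

lemma monom_val_superset:
  assumes "finite V" "Poly_Mapping.keys m \<subseteq> V"
  shows "monom_val \<rho> m = (\<Prod>v\<in>V. \<rho> v ^ Poly_Mapping.lookup m v)"
  unfolding monom_val_def using assms by (intro prod.mono_neutral_left) (auto simp: in_keys_iff)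

lemma monom_val_0 [simp]: "monom_val \<rho> 0 = 1"
  by (simp add: monom_val_def)

lemma monom_val_single [simp]: "monom_val \<rho> (Poly_Mapping.single v k) = \<rho> v ^ k"
  by (simp add: monom_val_def)

lemma monom_val_add: "monom_val \<rho> (m + m') = monom_val \<rho> m * monom_val \<rho> m'"
proof -
  define V where "V = Poly_Mapping.keys m \<union> Poly_Mapping.keys m'"
  have V: "finite V" "Poly_Mapping.keys m \<subseteq> V" "Poly_Mapping.keys m' \<subseteq> V" "Poly_Mapping.keys (m + m') \<subseteq> V"
    using keys_add[of m m'] by (auto simp: V_def)
  show ?thesis
    unfolding V(2-4)[THEN monom_val_superset[OF V(1)]]
    by (simp add: lookup_add power_add prod.distrib)
qed

lemma zpoly_subst_superset:
  assumes "finite A" "Poly_Mapping.keys p \<subseteq> A"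
  shows "zpoly_subst \<rho> p = (\<Sum>m\<in>A. of_int (Poly_Mapping.lookup p m) * monom_val \<rho> m)"
  unfolding zpoly_subst_def monom_val_def using assms
  by (intro sum.mono_neutral_left) (auto simp: in_keys_iff)

lemma zpoly_subst_0 [simp]: "zpoly_subst \<rho> 0 = 0"
  by (simp add: zpoly_subst_def)

lemma zpoly_subst_single: "zpoly_subst \<rho> (Poly_Mapping.single m c) = of_int c * monom_val \<rho> m"
  using zpoly_subst_superset[of "{m}" "Poly_Mapping.single m c" \<rho>] by (simp split: if_splits)

lemma zpoly_subst_zvar [simp]: "zpoly_subst \<rho> (zvar v) = \<rho> v"
  by (simp add: zvar_def zpoly_subst_single)

lemma zpoly_subst_1 [simp]: "zpoly_subst \<rho> 1 = 1"
  using zpoly_subst_single[of \<rho> 0 1] by simp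

lemma zpoly_subst_add: "zpoly_subst \<rho> (p + q) = zpoly_subst \<rho> p + zpoly_subst \<rho> q"
proof -
  define V where "V = Poly_Mapping.keys p \<union> Poly_Mapping.keys q"
  have V: "finite V" "Poly_Mapping.keys p \<subseteq> V" "Poly_Mapping.keys q \<subseteq> V" "Poly_Mapping.keys (p + q) \<subseteq> V"
    using keys_add[of p q] by (auto simp: V_def)
  show ?thesis
    unfolding V(2-4)[THEN zpoly_subst_superset[OF V(1)]]
    by (simp add: lookup_add algebra_simps sum.distrib)
qed

lemma zpoly_subst_sum: "zpoly_subst \<rho> (sum f A) = (\<Sum>x\<in>A. zpoly_subst \<rho> (f x))"
  by (induction A rule: infinite_finite_induct) (auto simp: zpoly_subst_add)

lemma poly_mapping_eq_sum_single:
  "p = (\<Sum>m\<in>Poly_Mapping.keys p. Poly_Mapping.single m (Poly_Mapping.lookup p m))"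
proof (rule poly_mapping_eqI)
  fix k
  have "Poly_Mapping.lookup p k = (\<Sum>m\<in>Poly_Mapping.keys p. if m = k then Poly_Mapping.lookup p k else 0)"
    by (auto simp: in_keys_iff)
  then show "Poly_Mapping.lookup p k =
      Poly_Mapping.lookup (\<Sum>m\<in>Poly_Mapping.keys p. Poly_Mapping.single m (Poly_Mapping.lookup p m)) k"
    by (simp add: lookup_sum lookup_single when_def if_distrib cong: sum.cong)
qed

lemma zpoly_subst_mult:
  fixes p q :: "'b zpoly"
  shows "zpoly_subst \<rho> (p * q) = zpoly_subst \<rho> p * zpoly_subst \<rho> q"
proof -
  let ?s = "\<lambda>p m. Poly_Mapping.single m (Poly_Mapping.lookup p m) :: 'b zpoly"
  have "zpoly_subst \<rho> (p * q) =
      zpoly_subst \<rho> ((\<Sum>m\<in>Poly_Mapping.keys p. ?s p m) * (\<Sum>m\<in>Poly_Mapping.keys q. ?s q m))"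
    by (simp flip: poly_mapping_eq_sum_single)
  also have "\<dots> = zpoly_subst \<rho> (\<Sum>m\<in>Poly_Mapping.keys p. ?s p m) * zpoly_subst \<rho> (\<Sum>m\<in>Poly_Mapping.keys q. ?s q m)"
    by (simp add: sum_product zpoly_subst_sum mult_single zpoly_subst_single monom_val_add mult_ac)
  finally show ?thesis
    by (simp flip: poly_mapping_eq_sum_single)
qed

lemma zpoly_subst_comm_ring_hom: "comm_ring_hom (zpoly_subst \<rho>)"
  by unfold_locales (auto simp: zpoly_subst_add zpoly_subst_mult)

lemma zpoly_subst_diff: "zpoly_subst \<rho> (p - q) = zpoly_subst \<rho> p - zpoly_subst \<rho> q"
proof -
  interpret comm_ring_hom "zpoly_subst \<rho>" by (rule zpoly_subst_comm_ring_hom)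
  show ?thesis by (rule hom_minus)
qed

lemma zpoly_subst_prod: "zpoly_subst \<rho> (prod f A) = (\<Prod>x\<in>A. zpoly_subst \<rho> (f x))"
  by (induction A rule: infinite_finite_induct) (auto simp: zpoly_subst_mult)

lemma zpoly_subst_power: "zpoly_subst \<rho> (p ^ n) = zpoly_subst \<rho> p ^ n"
  by (induction n) (auto simp: zpoly_subst_mult)

lemma zpoly_subst_of_int: "zpoly_subst \<rho> (of_int c) = of_int c"
proof -
  interpret comm_ring_hom "zpoly_subst \<rho>" by (rule zpoly_subst_comm_ring_hom)
  show ?thesis by (rule hom_of_int)
qed

lemma zpoly_subst_elem_sym: "zpoly_subst \<rho> (elem_sym k I x) = elem_sym k I (\<lambda>i. zpoly_subst \<rho> (x i))"
  by (simp add: elem_sym_def zpoly_subst_sum zpoly_subst_prod)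

lemma zpoly_subst_subst: "zpoly_subst \<rho> (zpoly_subst \<sigma> p) = zpoly_subst (\<lambda>v. zpoly_subst \<rho> (\<sigma> v)) p"
  by (simp add: zpoly_subst_def[of \<sigma>] zpoly_subst_def[of "\<lambda>v. zpoly_subst \<rho> (\<sigma> v)"]
      zpoly_subst_sum zpoly_subst_mult zpoly_subst_prod zpoly_subst_power zpoly_subst_of_int)

lemma zpoly_subst_cong:
  assumes "\<And>v. v \<in> zpoly_vars p \<Longrightarrow> \<rho> v = \<rho>' v"
  shows "zpoly_subst \<rho> p = zpoly_subst \<rho>' p"
  unfolding zpoly_subst_def using assms
  by (intro sum.cong refl arg_cong2[where f = "(*)"] prod.cong) (force simp: zpoly_vars_def)+

text \<open>By linearity the relation extends from powers to \<open>w * q(w)\<close> for every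
  polynomial \<open>q\<close>. The product \<open>q\<close> over the other nodes vanishes at all of
  them and isolates the coefficient at \<open>w k\<close>.\<close>

lemma exponential_sum_eq_0:
  fixes c :: "'a \<Rightarrow> complex"
  assumes K: "finite K" "inj_on w K" "\<And>k. k \<in> K \<Longrightarrow> w k \<noteq> 0"
    and sum0: "\<And>s. s > 0 \<Longrightarrow> (\<Sum>k\<in>K. c k * w k ^ s) = 0"
    and "k \<in> K"
  shows "c k = 0"
proof -
  define q where "q = (\<Prod>l\<in>K - {k}. [:- w l, 1:])"
  have "(\<Sum>l\<in>K. c l * w l * poly q (w l)) = (\<Sum>l\<in>K. \<Sum>s\<le>degree q. coeff q s * (c l * w l ^ Suc s))"
    by (simp add: poly_altdef sum_distrib_left mult_ac)
  also have "\<dots> = (\<Sum>s\<le>degree q. coeff q s * (\<Sum>l\<in>K. c l * w l ^ Suc s))"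
    by (subst sum.swap) (simp add: sum_distrib_left)
  also have "\<dots> = 0"
    by (subst sum0) auto
  also have "(\<Sum>l\<in>K. c l * w l * poly q (w l)) = (\<Sum>l\<in>{k}. c l * w l * poly q (w l))"
    using K \<open>k \<in> K\<close> by (intro sum.mono_neutral_right) (auto simp: q_def poly_prod)
  finally have "c k * w k * poly q (w k) = 0"
    by simp
  moreover have "poly q (w k) \<noteq> 0"
    using K \<open>k \<in> K\<close> by (auto simp: q_def poly_prod inj_on_def)
  ultimately show ?thesis
    using K \<open>k \<in> K\<close> by auto
qed

text \<open>Substituting the \<open>s\<close>-th powers of distinct primes for the variables turns the monomials into
  \<open>s\<close>-th powers of distinct integers.\<close>

lemma zpoly_eq_0I:
  fixes p :: "'v::countable zpoly"
  assumes "\<And>\<rho> :: 'v \<Rightarrow> complex. inj \<rho> \<Longrightarrow> zpoly_subst \<rho> p = 0"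
  shows "p = 0"
proof -
  define \<pi> :: "'v \<Rightarrow> nat" where "\<pi> v = from_nat_into {p. prime p} (to_nat v)" for v
  have inf: "infinite {p::nat. prime p}"
    using primes_infinite by simp
  have prime: "prime (\<pi> v)" for v
    using from_nat_into[of "{p::nat. prime p}"] primes_infinite by (auto simp: \<pi>_def) 
  have inj\<pi>: "inj \<pi>"
    using from_nat_into_inj_infinite[OF _ inf] by (auto simp: inj_def \<pi>_def)
  define w where "w m = monom_val (\<lambda>v. of_nat (\<pi> v) :: complex) m" for m
  define W where "W m = (\<Prod>v\<in>Poly_Mapping.keys m. \<pi> v ^ Poly_Mapping.lookup m v)" for m
  have wW: "w m = of_nat (W m)" for m
    by (simp add: w_def W_def monom_val_def)
  \<comment> \<open>By unique factorization the exponent of \<open>v\<close> is the multiplicity of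
    the prime \<open>\<pi> v\<close>, so a monomial can be read off from the integer
    \<open>W m\<close>.\<close>
  have mult: "multiplicity (\<pi> v) (W m) = Poly_Mapping.lookup m v" for m v
  proof -
    have "W m = (\<Prod>p\<in>\<pi> ` Poly_Mapping.keys m. p ^ Poly_Mapping.lookup m (inv_into UNIV \<pi> p))"
      unfolding W_def by (subst prod.reindex) (auto intro: inj_on_subset inj\<pi> simp: inj\<pi>)
    then have "multiplicity (\<pi> v) (W m) = (if \<pi> v \<in> \<pi> ` Poly_Mapping.keys m then Poly_Mapping.lookup m (inv_into UNIV \<pi> (\<pi> v)) else 0)"
      by (simp only:) (rule multiplicity_prod_prime_powers, auto simp: prime)
    then show ?thesis
      using inj\<pi> by (auto simp: in_keys_iff inj_image_mem_iff)
  qed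
  have "inj W"
    by (rule injI, rule poly_mapping_eqI) (metis mult)
  have "of_int (Poly_Mapping.lookup p m) = (0 :: complex)" if "m \<in> Poly_Mapping.keys p" for m
  proof (rule exponential_sum_eq_0[where w = w and K = "Poly_Mapping.keys p"])
    show "inj_on w (Poly_Mapping.keys p)"
      using \<open>inj W\<close> by (auto simp: inj_on_def wW)
    show "w k \<noteq> 0" for k
      using prime by (auto simp: wW W_def prime_gt_0_nat)
    show "(\<Sum>k\<in>Poly_Mapping.keys p. of_int (Poly_Mapping.lookup p k) * w k ^ s) = 0" if "s > 0" for s
    proof -
      \<comment> \<open>Powers of distinct primes stay distinct. The hypothesis covers only
        injective assignments, which later allows the determinant formula to assume distinct
        roots.\<close>
      have "inj (\<lambda>v. of_nat (\<pi> v) ^ s :: complex)"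
      proof (rule injI)
        fix u v assume "of_nat (\<pi> u) ^ s = (of_nat (\<pi> v) ^ s :: complex)"
        then have "\<pi> u ^ s = \<pi> v ^ s"
          by (metis of_nat_eq_iff of_nat_power)
        then show "u = v"
          using \<open>s > 0\<close> inj\<pi> by (metis injD power_eq_imp_eq_base le0)
      qed
      from assms[OF this] show ?thesis
        by (simp add: zpoly_subst_def w_def monom_val_def prod_power_distrib power_mult [symmetric] mult.commute)
    qed
  qed (use that in auto)
  then show ?thesis
    by (intro poly_mapping_eqI) (auto simp: in_keys_iff)
qed

section \<open>Elementary symmetric functions as coefficients of products of linear factors\<close>

lemma prod_add_eq_elem_sym:
  fixes x :: "'i \<Rightarrow> 'r::comm_ring_1"
  assumes "finite I"
  shows "(\<Prod>i\<in>I. u + x i * t) = (\<Sum>k\<le>card I. elem_sym k I x * t ^ k * u ^ (card I - k))"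
proof -
  have "(\<Prod>i\<in>I. x i * t + u) = (\<Sum>X\<in>Pow I. (\<Prod>i\<in>X. x i) * t ^ card X * u ^ (card I - card X))"
    using assms(1) by (subst prod_add) (auto simp: prod.distrib card_Diff_subset finite_subset)
  also have "\<dots> = (\<Sum>k\<le>card I. \<Sum>X\<in>{X\<in>Pow I. card X = k}. (\<Prod>i\<in>X. x i) * t ^ card X * u ^ (card I - card X))"
    using assms by (intro sum.group [symmetric]) (auto intro: card_mono)
  also have "\<dots> = (\<Sum>k\<le>card I. elem_sym k I x * t ^ k * u ^ (card I - k))"
    by (auto simp: elem_sym_def sum_distrib_right Pow_def intro!: sum.cong)
  finally show ?thesis
    by (simp add: add.commute)
qed

lemma prod_one_plus_eq_elem_sym:
  fixes x :: "'i \<Rightarrow> 'r::comm_ring_1"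
  assumes "finite I"
  shows "(\<Prod>i\<in>I. 1 + x i * t) = (\<Sum>k\<le>card I. elem_sym k I x * t ^ k)"
  using prod_add_eq_elem_sym[OF assms, of 1 x t] by simp

lemma elem_sym_0 [simp]: "finite I \<Longrightarrow> elem_sym 0 I x = 1"
proof -
  assume "finite I"
  then have "{S. S \<subseteq> I \<and> card S = 0} = {{}}"
    by (auto dest: finite_subset)
  then show ?thesis
    by (simp add: elem_sym_def)
qed

lemma elem_sym_eq_0: "finite I \<Longrightarrow> card I < k \<Longrightarrow> elem_sym k I x = 0"
  unfolding elem_sym_def by (rule sum.neutral) (metis (mono_tags, lifting) card_mono mem_Collect_eq not_le)

lemma coeff_prod_one_plus:
  fixes x :: "'i \<Rightarrow> 'r::comm_ring_1"
  assumes "finite I"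
  shows "coeff (\<Prod>i\<in>I. [:1, x i:]) k = elem_sym k I x"
proof -
  have "(\<Prod>i\<in>I. [:1, x i:]) = (\<Prod>i\<in>I. 1 + [:x i:] * [:0, 1:])"
    by (intro prod.cong) (auto simp: one_pCons)
  also have "\<dots> = (\<Sum>k\<le>card I. elem_sym k I (\<lambda>i. [:x i:]) * [:0, 1:] ^ k)"
    by (rule prod_one_plus_eq_elem_sym) (use assms in auto)
  also have "\<dots> = (\<Sum>k\<le>card I. monom (elem_sym k I x) k)"
  proof (intro sum.cong refl)
    fix k
    have *: "(\<Prod>i\<in>S. [:x i:]) = [:\<Prod>i\<in>S. x i:]" for S
      by (induction S rule: infinite_finite_induct) auto
    have "(\<Sum>S\<in>A. [:h S:]) = [:sum h A:]" for A :: "'i set set" and h :: "'i set \<Rightarrow> 'r"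
      by (induction A rule: infinite_finite_induct) auto
    then have "elem_sym k I (\<lambda>i. [:x i:]) = [:elem_sym k I x:]"
      by (simp add: elem_sym_def *)
    moreover have "[:0, 1:] ^ k = monom (1::'r) k"
      by (simp add: monom_altdef)
    ultimately show "elem_sym k I (\<lambda>i. [:x i:]) * [:0, 1:] ^ k = monom (elem_sym k I x) k"
      by (simp add: smult_monom)
  qed
  finally show ?thesis
    using assms by (simp add: coeff_sum elem_sym_eq_0 not_le)
qed

section \<open>Existence and uniqueness of the polynomials defining the e\~ne product\<close>

text \<open>If the \<open>c j\<close> are the coefficients of a relation \<open>x\<^sup>n = (\<Sum>j<n. c j * x\<^sup>j)\<close>, then
  \<open>comp_red n c k j\<close> is the coefficient of \<open>x\<^sup>j\<close> in the reduction of \<open>x\<^sup>k\<close>.\<close>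

fun comp_red :: "nat \<Rightarrow> (nat \<Rightarrow> 'a::comm_ring_1) \<Rightarrow> nat \<Rightarrow> nat \<Rightarrow> 'a" where
  "comp_red n c 0 j = (if j = 0 then 1 else 0)"
| "comp_red n c (Suc k) j = (if j = 0 then 0 else comp_red n c k (j - 1)) + comp_red n c k (n - 1) * c j"

lemma power_eq_comp_red:
  fixes x :: "'a::comm_ring_1"
  assumes "n > 0" and rel: "x ^ n = (\<Sum>j<n. c j * x ^ j)"
  shows "x ^ k = (\<Sum>j<n. comp_red n c k j * x ^ j)"
proof (induction k)
  case 0
  have "(\<Sum>j<n. comp_red n c 0 j * x ^ j) = (\<Sum>j<n. if j = 0 then 1 else 0)"
    by (intro sum.cong) auto
  then show ?case
    using assms(1) by simp
next
  case (Suc k)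
  obtain m where n: "n = Suc m"
    using assms(1) by (cases n) auto
  let ?r = "comp_red n c k"
  have "x ^ Suc k = (\<Sum>j<Suc m. ?r j * x ^ Suc j)"
    by (simp add: Suc sum_distrib_left distrib_left mult_ac n)
  also have "\<dots> = (\<Sum>j<m. ?r j * x ^ Suc j) + ?r m * x ^ n"
    by (simp add: n)
  also have "x ^ n = (\<Sum>j<n. c j * x ^ j)"
    by (rule rel)
  also have "(\<Sum>j<m. ?r j * x ^ Suc j) = (\<Sum>j<n. (if j = 0 then 0 else ?r (j - 1)) * x ^ j)"
    unfolding n by (subst sum.lessThan_Suc_shift) simp
  finally show ?case
    by (simp add: n sum_distrib_left sum.distrib [symmetric] algebra_simps cong: if_cong)
qed

lemma (in comm_ring_hom) hom_comp_red: "hom (comp_red n c k j) = comp_red n (\<lambda>i. hom (c i)) k j"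
  by (induction k arbitrary: j) (auto simp: hom_distribs)

text \<open>Row \<open>i\<close> reduces \<open>X^i\<close> times the polynomial with coefficients
  \<open>a\<close>. The entries are ring expressions in \<open>c\<close> and \<open>a\<close>, so
  the determinant, a resultant, makes sense over integer polynomials and commutes with
  substitution.\<close>

definition comp_mat :: "nat \<Rightarrow> (nat \<Rightarrow> 'a::comm_ring_1) \<Rightarrow> nat \<Rightarrow> (nat \<Rightarrow> 'a) \<Rightarrow> 'a Matrix.mat" where
  "comp_mat n c d a = Matrix.mat n n (\<lambda>(i, j). \<Sum>k\<le>d. a k * comp_red n c (k + i) j)"

lemma comp_mat_cong:
  assumes "\<And>j. j < n \<Longrightarrow> c j = c' j" "\<And>k. k \<le> d \<Longrightarrow> a k = a' k"
  shows "comp_mat n c d a = comp_mat n c' d a'"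
proof -
  have "comp_red n c k j = comp_red n c' k j" if "j < n" for k j
    using that by (induction k arbitrary: j) (auto simp: assms(1))
  then show ?thesis
    unfolding comp_mat_def by (intro cong_mat) (auto simp: assms(2) intro!: sum.cong)
qed

lemma (in comm_ring_hom) hom_det_comp_mat:
  "hom (Determinant.det (comp_mat n c d a)) =
     Determinant.det (comp_mat n (\<lambda>i. hom (c i)) d (\<lambda>k. hom (a k)))"
proof -
  have "map_mat hom (comp_mat n c d a) = comp_mat n (\<lambda>i. hom (c i)) d (\<lambda>k. hom (a k))"
    by (rule eq_matI) (auto simp: comp_mat_def hom_distribs hom_comp_red)
  then show ?thesis
    by (metis hom_det)
qed

text \<open>A kernel vector would be the coefficient vector of a nonzero polynomial of degree below
  \<open>n\<close> with \<open>n\<close> distinct roots.\<close>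

lemma det_vandermonde_nonzero:
  fixes x :: "nat \<Rightarrow> 'a::field"
  assumes "inj_on x {..<n}"
  shows "Determinant.det (Matrix.mat n n (\<lambda>(l, j). x l ^ j)) \<noteq> 0"
proof
  let ?V = "Matrix.mat n n (\<lambda>(l, j). x l ^ j)"
  assume "Determinant.det ?V = 0"
  moreover have "?V \<in> carrier_mat n n"
    by simp
  ultimately obtain v where v: "v \<in> carrier_vec n" "v \<noteq> 0\<^sub>v n" "?V *\<^sub>v v = 0\<^sub>v n"
    using det_0_iff_vec_prod_zero_field by metis
  define p where "p = (\<Sum>j<n. monom (vec_index v j) j)"
  have coeff: "coeff p j = (if j < n then vec_index v j else 0)" for j
    by (simp add: p_def coeff_sum)
  have "poly p (x l) = 0" if "l < n" for l
  proof -
    have "vec_index (?V *\<^sub>v v) l = 0"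
      using v that by simp
    then show ?thesis
      using that v(1) by (simp add: p_def poly_sum poly_monom scalar_prod_def mult.commute atLeast0LessThan)
  qed
  have "p = 0"
  proof (rule ccontr)
    assume "p \<noteq> 0"
    then have "card {y. poly p y = 0} \<le> degree p" "finite {y. poly p y = 0}"
      by (simp_all add: card_poly_roots_bound poly_roots_finite)
    moreover have "x ` {..<n} \<subseteq> {y. poly p y = 0}"
      using \<open>\<And>l. l < n \<Longrightarrow> poly p (x l) = 0\<close> by auto
    ultimately have "card (x ` {..<n}) \<le> degree p"
      by (meson card_mono le_trans)
    then have "n \<le> degree p"
      by (simp add: card_image assms)
    then show False
      using coeff[of "degree p"] \<open>p \<noteq> 0\<close> by simp
  qed
  then have "v = 0\<^sub>v n"
    using v(1) coeff by (intro eq_vecI) (auto, metis coeff_0)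
  with v show False
    by simp
qed

text \<open>The matrix \<open>comp_mat\<close> represents multiplication by \<open>\<Sum>k\<le>d. a k * X\<^sup>k\<close> modulo
  \<open>X\<^sup>n - (\<Sum>j<n. c j * X\<^sup>j)\<close>. The Vandermonde matrix of the roots diagonalizes it.\<close>

lemma det_comp_mat:
  fixes x :: "nat \<Rightarrow> 'a::field"
  assumes "n > 0" "inj_on x {..<n}" and rel: "\<And>l. l < n \<Longrightarrow> x l ^ n = (\<Sum>j<n. c j * x l ^ j)"
  shows "Determinant.det (comp_mat n c d a) = (\<Prod>l<n. \<Sum>k\<le>d. a k * x l ^ k)"
proof -
  define V where "V = Matrix.mat n n (\<lambda>(j, l). x l ^ j)"
  define D where "D = Matrix.mat n n (\<lambda>(i, l). if i = l then \<Sum>k\<le>d. a k * x l ^ k else 0)"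
  have carrier: "V \<in> carrier_mat n n" "D \<in> carrier_mat n n" "comp_mat n c d a \<in> carrier_mat n n"
    by (auto simp: V_def D_def comp_mat_def)
  have "comp_mat n c d a * V = V * D"
  proof (rule eq_matI)
    fix i l assume "i < dim_row (V * D)" "l < dim_col (V * D)"
    then have il: "i < n" "l < n"
      by (auto simp: V_def D_def)
    have "(comp_mat n c d a * V) $$ (i, l) = (\<Sum>j<n. (\<Sum>k\<le>d. a k * comp_red n c (k + i) j) * x l ^ j)"
      using il by (simp add: comp_mat_def V_def scalar_prod_def atLeast0LessThan)
    also have "\<dots> = (\<Sum>k\<le>d. a k * (\<Sum>j<n. comp_red n c (k + i) j * x l ^ j))"
      by (simp add: sum_distrib_right sum_distrib_left mult.assoc) (rule sum.swap)
    also have "\<dots> = (\<Sum>k\<le>d. a k * x l ^ (k + i))"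
      by (simp only: power_eq_comp_red[OF \<open>n > 0\<close> rel[OF il(2)], symmetric])
    also have "\<dots> = x l ^ i * (\<Sum>k\<le>d. a k * x l ^ k)"
      by (simp add: sum_distrib_left power_add mult_ac)
    also have "\<dots> = (V * D) $$ (i, l)"
      using il by (simp add: V_def D_def scalar_prod_def if_distrib cong: if_cong)
    finally show "(comp_mat n c d a * V) $$ (i, l) = (V * D) $$ (i, l)" .
  qed (auto simp: comp_mat_def V_def D_def)
  then have "Determinant.det (comp_mat n c d a) * Determinant.det V = Determinant.det V * Determinant.det D"
    using det_mult[OF carrier(3,1)] det_mult[OF carrier(1,2)] by metis
  moreover have "Determinant.det V \<noteq> 0"
  proof -
    have "transpose_mat V = Matrix.mat n n (\<lambda>(l, j). x l ^ j)"
      by (rule eq_matI) (auto simp: V_def)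
    then show ?thesis
      using det_vandermonde_nonzero[OF assms(2)] det_transpose[OF carrier(1)] by simp
  qed
  moreover have "Determinant.det D = (\<Prod>l<n. \<Sum>k\<le>d. a k * x l ^ k)"
    using carrier(2)
    by (subst det_upper_triangular) (auto simp: D_def prod_list_diag_prod atLeast0LessThan)
  ultimately show ?thesis
    by simp
qed

text \<open>An explicit candidate for \<open>Q_n\<close>. With \<open>Inl k\<close> standing for
  \<open>e_k(x)\<close>, the relation given by \<open>c\<close> has the \<open>x_i\<close> as roots,
  by Vieta. With \<open>Inr k\<close> standing for \<open>e_k(y)\<close>, the other polynomial is
  the product of the \<open>1 + y_j t X\<close>, where \<open>t\<close> is the variable of the outer
  polynomial ring; the case \<open>k = 0\<close> supplies \<open>e_0 = 1\<close>. The determinant is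
  then the product of all \<open>1 + x_i y_j t\<close>, and its coefficient of \<open>t^n\<close> is
  wanted.\<close>

definition ene_coeff :: "nat \<Rightarrow> (nat + nat) zpoly" where
  "ene_coeff n = coeff (Determinant.det (comp_mat n (\<lambda>j. [:- ((- 1) ^ (n - j)) * zvar (Inl (n - j)):]) n
      (\<lambda>k. monom (if k = 0 then 1 else zvar (Inr k)) k))) n"

text \<open>For distinct \<open>x_i\<close> the Vandermonde matrix is invertible and
  \<open>det_comp_mat\<close> evaluates the determinant as a product over the roots. The two
  polynomials in \<open>t\<close> are compared as functions.\<close>

lemma zpoly_subst_ene_coeff:
  fixes x y :: "nat \<Rightarrow> complex"
  assumes "n > 0" and inj: "inj_on x {1..n}"
    and \<rho>: "\<And>k. k \<in> {1..n} \<Longrightarrow> \<rho> (Inl k) = elem_sym k {1..n} x"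
      "\<And>k. k \<in> {1..n} \<Longrightarrow> \<rho> (Inr k) = elem_sym k {1..n} y"
  shows "zpoly_subst \<rho> (ene_coeff n) = elem_sym n ({1..n} \<times> {1..n}) (\<lambda>(i, j). x i * y j)"
proof -
  let ?M = "comp_mat n (\<lambda>j. [:- ((- 1) ^ (n - j)) * zvar (Inl (n - j)):]) n
      (\<lambda>k. monom (if k = 0 then 1 else zvar (Inr k)) k) :: (nat + nat) zpoly poly Matrix.mat"
  interpret h: comm_ring_hom "zpoly_subst \<rho>"
    by (rule zpoly_subst_comm_ring_hom)
  interpret map: map_poly_comm_ring_hom "zpoly_subst \<rho>" ..
  define c where "c j = - ((- 1) ^ (n - j)) * elem_sym (n - j) {1..n} x" for j
  have h_sign: "zpoly_subst \<rho> ((- 1) ^ k) = (- 1) ^ k" for k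
    by (simp add: zpoly_subst_power h.hom_uminus)
  \<comment> \<open>The roots are numbered from 1, the matrix rows from 0; hence the shift by
    \<open>Suc\<close>.\<close>
  have inj': "inj_on (\<lambda>l. x (Suc l)) {..<n}"
  proof (rule inj_onI)
    fix a b assume "a \<in> {..<n}" "b \<in> {..<n}" "x (Suc a) = x (Suc b)"
    then have "Suc a = Suc b"
      by (intro inj_onD[OF inj]) auto
    then show "a = b"
      by simp
  qed
  define p where "p = map_poly (zpoly_subst \<rho>) (Determinant.det ?M)"
  have "p = (\<Prod>(i, j)\<in>{1..n} \<times> {1..n}. [:1, x i * y j:])"
  proof (rule poly_eq_poly_eq_iff[THEN iffD1], rule ext)
    fix t
    \<comment> \<open>Substituting into the coefficients and then evaluating at \<open>t\<close> is
      a ring homomorphism, so it moves inside the determinant.\<close>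
    interpret ev: comm_ring_hom "\<lambda>q. poly (map_poly (zpoly_subst \<rho>) q) t"
      by unfold_locales (simp_all add: hom_distribs)
    have h_const: "poly (map_poly (zpoly_subst \<rho>) [:q:]) t = zpoly_subst \<rho> q" for q
      by (simp add: Polynomial.map_poly_pCons)
    \<comment> \<open>Each root annihilates the product of the \<open>X - x_i\<close>, which is
      expanded by \<open>prod_add_eq_elem_sym\<close> with second variable
      \<open>- 1\<close>.\<close>
    have rel: "x (Suc l) ^ n = (\<Sum>j<n. c j * x (Suc l) ^ j)" if "l < n" for l
    proof -
      have "0 = (\<Prod>i\<in>{1..n}. x (Suc l) + x i * (- 1))"
        using that by (intro prod_zero [symmetric]) (auto intro!: bexI[of _ "Suc l"])
      also have "\<dots> = (\<Sum>k<Suc n. elem_sym k {1..n} x * (- 1) ^ k * x (Suc l) ^ (n - k))"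
        by (subst prod_add_eq_elem_sym) (simp_all add: lessThan_Suc_atMost)
      also have "\<dots> = x (Suc l) ^ n + (\<Sum>k<n. elem_sym (Suc k) {1..n} x * (- 1) ^ Suc k * x (Suc l) ^ (n - Suc k))"
        by (subst sum.lessThan_Suc_shift) simp
      also have "(\<Sum>k<n. elem_sym (Suc k) {1..n} x * (- 1) ^ Suc k * x (Suc l) ^ (n - Suc k)) =
          (\<Sum>k<n. - (c (n - Suc k) * x (Suc l) ^ (n - Suc k)))"
        by (intro sum.cong) (auto simp: c_def Suc_diff_Suc)
      also have "\<dots> = - (\<Sum>j<n. c j * x (Suc l) ^ j)"
        unfolding sum_negf using sum.nat_diff_reindex[of "\<lambda>j. c j * x (Suc l) ^ j" n] by simp
      finally show ?thesis
        by (simp add: eq_neg_iff_add_eq_0 [symmetric])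
    qed
    have eq: "comp_mat n
        (\<lambda>j. poly (map_poly (zpoly_subst \<rho>) [:- ((- 1) ^ (n - j)) * zvar (Inl (n - j)):]) t) n
        (\<lambda>k. poly (map_poly (zpoly_subst \<rho>) (monom (if k = 0 then 1 else zvar (Inr k)) k)) t) =
        comp_mat n c n (\<lambda>k. elem_sym k {1..n} y * t ^ k)"
    proof (rule comp_mat_cong)
      show "poly (map_poly (zpoly_subst \<rho>) [:- ((- 1) ^ (n - j)) * zvar (Inl (n - j)):]) t = c j" if "j < n" for j
        unfolding h_const using that by (simp add: c_def \<rho> zpoly_subst_mult h.hom_uminus h_sign)
      show "poly (map_poly (zpoly_subst \<rho>) (monom (if k = 0 then 1 else zvar (Inr k)) k)) t =
          elem_sym k {1..n} y * t ^ k" if "k \<le> n" for k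
        using that by (simp add: \<rho> map_poly_monom poly_monom)
    qed
    have "poly p t = Determinant.det (comp_mat n c n (\<lambda>k. elem_sym k {1..n} y * t ^ k))"
      unfolding p_def ev.hom_det_comp_mat eq by (rule refl)
    also have "\<dots> = (\<Prod>l<n. \<Sum>k\<le>n. (elem_sym k {1..n} y * t ^ k) * x (Suc l) ^ k)"
      using inj' rel by (rule det_comp_mat[OF \<open>n > 0\<close>])
    also have "\<dots> = (\<Prod>i\<in>{1..n}. \<Sum>k\<le>n. elem_sym k {1..n} y * (x i * t) ^ k)"
      by (rule prod.reindex_bij_witness[of _ "\<lambda>i. i - 1" Suc]) (auto simp: power_mult_distrib mult_ac)
    also have "\<dots> = (\<Prod>i\<in>{1..n}. \<Prod>j\<in>{1..n}. 1 + y j * (x i * t))"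
      using prod_one_plus_eq_elem_sym[of "{1..n}" y] by simp
    also have "\<dots> = poly (\<Prod>(i, j)\<in>{1..n} \<times> {1..n}. [:1, x i * y j:]) t"
      by (simp add: poly_prod prod.cartesian_product case_prod_unfold mult_ac)
    finally show "poly p t = poly (\<Prod>(i, j)\<in>{1..n} \<times> {1..n}. [:1, x i * y j:]) t" .
  qed
  then have "coeff p n = elem_sym n ({1..n} \<times> {1..n}) (\<lambda>(i, j). x i * y j)"
    using coeff_prod_one_plus[of "{1..n} \<times> {1..n}" "\<lambda>(i, j). x i * y j" n]
    by (simp add: case_prod_unfold)
  then show ?thesis
    by (simp add: p_def ene_coeff_def)
qed

text \<open>Discarding the monomials with a variable outside \<open>V\<close> amounts to
  substituting 0 for these variables. This meets the condition on variables in
  \<open>is_ene_poly\<close> without tracking which variables occur in the determinant.\<close>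

definition zpoly_restrict :: "'v set \<Rightarrow> 'v zpoly \<Rightarrow> 'v zpoly" where
  "zpoly_restrict V p = (\<Sum>m | m \<in> Poly_Mapping.keys p \<and> Poly_Mapping.keys m \<subseteq> V.
     Poly_Mapping.single m (Poly_Mapping.lookup p m))"

lemma zpoly_vars_restrict: "zpoly_vars (zpoly_restrict V p) \<subseteq> V"
proof -
  have "Poly_Mapping.keys (zpoly_restrict V p) \<subseteq> {m. Poly_Mapping.keys m \<subseteq> V}"
    unfolding zpoly_restrict_def by (rule order_trans[OF keys_sum]) (auto split: if_splits)
  then show ?thesis
    by (auto simp: zpoly_vars_def)
qed

lemma zpoly_subst_restrict:
  "zpoly_subst \<rho> (zpoly_restrict V p) = zpoly_subst (\<lambda>v. if v \<in> V then \<rho> v else 0) p"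
proof -
  let ?\<rho> = "\<lambda>v. if v \<in> V then \<rho> v else 0"
  have *: "monom_val ?\<rho> m = (if Poly_Mapping.keys m \<subseteq> V then monom_val \<rho> m else 0)" for m
  proof (cases "Poly_Mapping.keys m \<subseteq> V")
    case True
    then show ?thesis
      by (auto simp: monom_val_def intro!: prod.cong)
  next
    case False
    then obtain v where "v \<in> Poly_Mapping.keys m" "v \<notin> V"
      by auto
    then show ?thesis
      using False by (auto simp: monom_val_def in_keys_iff power_0_left intro!: prod_zero bexI[of _ v])
  qed
  have "zpoly_subst ?\<rho> p = (\<Sum>m\<in>Poly_Mapping.keys p. of_int (Poly_Mapping.lookup p m) * monom_val ?\<rho> m)"
    by (rule zpoly_subst_superset) auto
  also have "\<dots> = (\<Sum>m | m \<in> Poly_Mapping.keys p \<and> Poly_Mapping.keys m \<subseteq> V.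
      of_int (Poly_Mapping.lookup p m) * monom_val \<rho> m)"
    by (subst sum.inter_filter) (auto simp: * intro!: sum.cong)
  finally show ?thesis
    by (simp add: zpoly_restrict_def zpoly_subst_sum zpoly_subst_single)
qed

text \<open>The defining identity is verified at injective complex assignments, where the
  \<open>x_i\<close> are distinct, and \<open>zpoly_eq_0I\<close> lifts it to polynomials. The
  explicit determinant takes the place of the fundamental theorem on symmetric polynomials.\<close>

lemma ex_is_ene_poly:
  assumes "n > 0"
  shows "\<exists>Q. is_ene_poly n Q"
proof
  let ?V = "Inl ` {1..n} \<union> Inr ` {1..n}"
  let ?Q = "zpoly_restrict ?V (ene_coeff n)"
  let ?\<sigma> = "case_sum (\<lambda>k. elem_sym k {1..n} (\<lambda>i. zvar (Inl i))) (\<lambda>k. elem_sym k {1..n} (\<lambda>j. zvar (Inr j)))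
    :: nat + nat \<Rightarrow> (nat + nat) zpoly"
  have "zpoly_subst ?\<sigma> ?Q - elem_sym n ({1..n} \<times> {1..n}) (\<lambda>(i, j). zvar (Inl i) * zvar (Inr j)) = 0"
  proof (rule zpoly_eq_0I)
    fix \<rho> :: "nat + nat \<Rightarrow> complex" assume "inj \<rho>"
    then have "inj_on (\<lambda>i. \<rho> (Inl i)) {1..n}"
      by (auto simp: inj_on_def)
    then have "zpoly_subst (\<lambda>v. if v \<in> ?V then zpoly_subst \<rho> (?\<sigma> v) else 0) (ene_coeff n) =
        elem_sym n ({1..n} \<times> {1..n}) (\<lambda>(i, j). \<rho> (Inl i) * \<rho> (Inr j))"
      by (rule zpoly_subst_ene_coeff[OF assms]) (auto simp: zpoly_subst_elem_sym)
    moreover have "(\<lambda>v. zpoly_subst \<rho> (if v \<in> ?V then ?\<sigma> v else 0)) =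
        (\<lambda>v. if v \<in> ?V then zpoly_subst \<rho> (?\<sigma> v) else 0)"
      by auto
    ultimately show "zpoly_subst \<rho> (zpoly_subst ?\<sigma> ?Q - elem_sym n ({1..n} \<times> {1..n}) (\<lambda>(i, j). zvar (Inl i) * zvar (Inr j))) = 0"
      by (simp only: zpoly_subst_diff zpoly_subst_subst zpoly_subst_restrict zpoly_subst_elem_sym
          zpoly_subst_mult zpoly_subst_zvar case_prod_unfold diff_self)
  qed
  then show "is_ene_poly n ?Q"
    using zpoly_vars_restrict[of ?V] by (simp add: is_ene_poly_def)
qed

text \<open>Constant term 1 excludes the root 0, so each factor \<open>X - r\<close> can be rescaled
  to \<open>1 - X / r\<close>, and the scalars multiply to 1. Zero values of \<open>x\<close> pad
  the product when the degree is below \<open>n\<close>.\<close>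

lemma poly_eq_prod_one_plus:
  fixes p :: "complex poly"
  assumes "coeff p 0 = 1" "degree p \<le> n"
  obtains x where "p = (\<Prod>i\<in>{1..n}. [:1, x i:])"
proof -
  obtain r where r: "Polynomial.smult (lead_coeff p) (\<Prod>i<degree p. [:- r i, 1:]) = p"
    using complex_poly_decompose' by blast
  have "poly p 0 = 1"
    using assms by (simp add: poly_0_coeff_0)
  then have lc: "lead_coeff p * (\<Prod>i<degree p. - r i) = 1"
    by (subst (asm) r [symmetric]) (simp add: poly_prod)
  have nz: "r i \<noteq> 0" if "i < degree p" for i
  proof
    assume "r i = 0"
    then have "(\<Prod>i<degree p. - r i) = 0"
      using that by (intro prod_zero) auto
    with lc show False
      by simp
  qed
  define x where "x i = (if i \<le> degree p then - 1 / r (i - 1) else 0)" for i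
  have "(\<Prod>i\<in>{1..n}. [:1, x i:]) = (\<Prod>i\<in>{1..degree p}. [:1, x i:])"
    using assms(2) by (intro prod.mono_neutral_right) (auto simp: x_def one_pCons)
  also have "\<dots> = (\<Prod>i<degree p. [:1, - 1 / r i:])"
    by (rule prod.reindex_bij_witness[of _ Suc "\<lambda>i. i - 1"]) (auto simp: x_def)
  finally have x: "(\<Prod>i\<in>{1..n}. [:1, x i:]) = (\<Prod>i<degree p. [:1, - 1 / r i:])" .
  have "(\<Prod>i<degree p. [:- r i, 1:]) = (\<Prod>i<degree p. Polynomial.smult (- r i) [:1, - 1 / r i:])"
    by (intro prod.cong) (auto simp: nz)
  also have "\<dots> = Polynomial.smult (\<Prod>i<degree p. - r i) (\<Prod>i<degree p. [:1, - 1 / r i:])"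
    by (rule prod_smult)
  finally have "p = Polynomial.smult (lead_coeff p * (\<Prod>i<degree p. - r i)) (\<Prod>i<degree p. [:1, - 1 / r i:])"
    using r by simp
  then show ?thesis
    using that[of x] by (simp only: lc x smult_1_left)
qed

text \<open>Prescribed values become the coefficients of a polynomial with constant term 1, which
  splits over the complex numbers. This serves the uniqueness of \<open>Q_n\<close> and the
  replacement of power series by finite products.\<close>

lemma ex_elem_sym_eq:
  obtains x :: "nat \<Rightarrow> complex" where "\<And>k. k \<in> {1..n} \<Longrightarrow> elem_sym k {1..n} x = a k"
proof -
  define p where "p = (\<Sum>k\<le>n. monom (if k = 0 then 1 else a k) k)"
  have coeff: "coeff p k = (if k \<le> n then if k = 0 then 1 else a k else 0)" for k
    by (simp add: p_def coeff_sum)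
  have "degree p \<le> n"
    by (rule degree_le) (auto simp: coeff)
  then obtain x where "p = (\<Prod>i\<in>{1..n}. [:1, x i:])"
    using poly_eq_prod_one_plus[of p n] coeff[of 0] by auto
  then have "elem_sym k {1..n} x = coeff p k" for k
    by (simp add: coeff_prod_one_plus)
  then show ?thesis
    by (intro that[of x]) (auto simp: coeff)
qed

lemma is_ene_poly_subst:
  fixes x y :: "nat \<Rightarrow> complex"
  assumes "is_ene_poly n Q"
    and \<rho>: "\<And>k. k \<in> {1..n} \<Longrightarrow> \<rho> (Inl k) = elem_sym k {1..n} x"
      "\<And>k. k \<in> {1..n} \<Longrightarrow> \<rho> (Inr k) = elem_sym k {1..n} y"
  shows "zpoly_subst \<rho> Q = elem_sym n ({1..n} \<times> {1..n}) (\<lambda>(i, j). x i * y j)"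
proof -
  let ?\<sigma> = "case_sum (\<lambda>k. elem_sym k {1..n} (\<lambda>i. zvar (Inl i))) (\<lambda>k. elem_sym k {1..n} (\<lambda>j. zvar (Inr j)))
    :: nat + nat \<Rightarrow> (nat + nat) zpoly"
  have "zpoly_subst \<rho> Q = zpoly_subst (\<lambda>v. zpoly_subst (case_sum x y) (?\<sigma> v)) Q"
    using assms by (intro zpoly_subst_cong) (force simp: is_ene_poly_def zpoly_subst_elem_sym)
  also have "\<dots> = zpoly_subst (case_sum x y) (zpoly_subst ?\<sigma> Q)"
    by (rule zpoly_subst_subst [symmetric])
  also have "zpoly_subst ?\<sigma> Q = elem_sym n ({1..n} \<times> {1..n}) (\<lambda>(i, j). zvar (Inl i) * zvar (Inr j))"
    using assms by (simp add: is_ene_poly_def)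
  finally show ?thesis
    by (simp add: zpoly_subst_elem_sym zpoly_subst_mult case_prod_unfold)
qed

text \<open>Any complex values of the variables \<open>X_k\<close>, \<open>Y_k\<close> with
  \<open>k\<close> in \<open>{1..n}\<close> are elementary symmetric functions of suitable
  \<open>x\<close> and \<open>y\<close>, so two candidates agree at every complex point.\<close>

lemma is_ene_poly_unique:
  assumes "is_ene_poly n Q" "is_ene_poly n Q'"
  shows "Q = Q'"
proof -
  have "Q - Q' = 0"
  proof (rule zpoly_eq_0I)
    fix \<rho> :: "nat + nat \<Rightarrow> complex"
    obtain x where "\<And>k. k \<in> {1..n} \<Longrightarrow> elem_sym k {1..n} x = \<rho> (Inl k)"
      using ex_elem_sym_eq[of n "\<lambda>k. \<rho> (Inl k)"] by blast
    moreover obtain y where "\<And>k. k \<in> {1..n} \<Longrightarrow> elem_sym k {1..n} y = \<rho> (Inr k)"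
      using ex_elem_sym_eq[of n "\<lambda>k. \<rho> (Inr k)"] by blast
    ultimately show "zpoly_subst \<rho> (Q - Q') = 0"
      using is_ene_poly_subst[OF assms(1), of \<rho> x y] is_ene_poly_subst[OF assms(2), of \<rho> x y]
      by (simp add: zpoly_subst_diff)
  qed
  then show ?thesis
    by simp
qed

lemma is_ene_poly_ene_poly: "n > 0 \<Longrightarrow> is_ene_poly n (ene_poly n)"
  unfolding ene_poly_def using ex_is_ene_poly is_ene_poly_unique by (metis theI)

section \<open>The e\~ne product and power sums of zeros\<close>

text \<open>The coefficients of \<open>- z f'/f\<close> are the power sums of the inverse zeros of \<open>f\<close>.\<close>

definition psum :: "complex fps \<Rightarrow> complex fps" where
  "psum f = - (fps_X * fps_deriv f) * inverse f"

text \<open>The inverse of \<open>psum\<close>: the logarithmic derivative is integrated termwise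
  and exponentiated. At index 0 the division by zero yields 0, so the inner series has no constant
  term and the composition is legitimate.\<close>

definition fps_of_psum :: "complex fps \<Rightarrow> complex fps" where
  "fps_of_psum a = fps_exp 1 oo Abs_fps (\<lambda>n. - fps_nth a n / of_nat n)"

definition fps_hadamard :: "complex fps \<Rightarrow> complex fps \<Rightarrow> complex fps" where
  "fps_hadamard a b = Abs_fps (\<lambda>n. fps_nth a n * fps_nth b n)"

lemma fps_hadamard_nth [simp]: "fps_nth (fps_hadamard a b) n = fps_nth a n * fps_nth b n"
  by (simp add: fps_hadamard_def)

lemma psum_nth_0 [simp]: "fps_nth (psum f) 0 = 0"
  by (simp add: psum_def)

lemma psum_mult_self: "fps_nth f 0 = 1 \<Longrightarrow> psum f * f = - (fps_X * fps_deriv f)"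
  by (simp add: psum_def mult.assoc inverse_mult_eq_1)

lemma psum_eqI_mult: "fps_nth f 0 = 1 \<Longrightarrow> a * f = - (fps_X * fps_deriv f) \<Longrightarrow> psum f = a"
  by (metis psum_mult_self fps_nonzero_nth mult_cancel_right zero_neq_one fps_zero_nth)

lemma psum_1 [simp]: "psum 1 = 0"
  by (simp add: psum_def)

lemma psum_mult:
  assumes "fps_nth f 0 = 1" "fps_nth g 0 = 1"
  shows "psum (f * g) = psum f + psum g"
proof (rule psum_eqI_mult)
  have "(psum f + psum g) * (f * g) = (psum f * f) * g + (psum g * g) * f"
    by (simp add: algebra_simps)
  also have "\<dots> = - (fps_X * fps_deriv f) * g + - (fps_X * fps_deriv g) * f"
    by (simp only: psum_mult_self assms)
  finally show "(psum f + psum g) * (f * g) = - (fps_X * fps_deriv (f * g))"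
    by (simp add: algebra_simps)
qed (use assms in simp)

lemma fps_nth_prod_0: "fps_nth (prod f A) 0 = (\<Prod>i\<in>A. fps_nth (f i) 0)"
  by (induction A rule: infinite_finite_induct) auto

lemma psum_prod:
  "(\<And>i. i \<in> A \<Longrightarrow> fps_nth (f i) 0 = 1) \<Longrightarrow> psum (prod f A) = (\<Sum>i\<in>A. psum (f i))"
  by (induction A rule: infinite_finite_induct) (auto simp: psum_mult fps_nth_prod_0)

text \<open>The quotient of the two series has zero logarithmic derivative, hence is the constant
  1.\<close>

lemma psum_inject:
  assumes f: "fps_nth f 0 = 1" and g: "fps_nth g 0 = 1" and eq: "psum f = psum g"
  shows "f = g"
proof -
  define q where "q = f * inverse g"
  have q: "fps_nth q 0 = 1" "q * g = f"
    using f g by (simp_all add: q_def mult.assoc inverse_mult_eq_1)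
  then have "psum q = 0"
    using psum_mult[of q g] g eq by simp
  then have "fps_X * fps_deriv q = 0"
    using psum_mult_self[OF q(1)] by simp
  then have "fps_deriv q = 0"
    by simp
  then have "q = 1"
    using q(1) by (metis fps_deriv_eq_0_iff fps_const_1_eq_1)
  then show ?thesis
    using q by simp
qed

lemma
  assumes "fps_nth a 0 = 0"
  shows fps_of_psum_nth_0: "fps_nth (fps_of_psum a) 0 = 1"
    and psum_fps_of_psum: "psum (fps_of_psum a) = a"
proof -
  define b where "b = Abs_fps (\<lambda>n. - fps_nth a n / of_nat n)"
  have b0: "fps_nth b 0 = 0"
    by (simp add: b_def)
  show *: "fps_nth (fps_of_psum a) 0 = 1"
    by (simp add: fps_of_psum_def)
  have "fps_X * fps_deriv b = - a"
    using assms by (intro fps_ext) (auto simp: b_def fps_X_mult_nth fps_deriv_nth)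
  moreover have "fps_of_psum a = fps_exp 1 oo b"
    by (simp only: fps_of_psum_def b_def)
  then have "fps_deriv (fps_of_psum a) = fps_of_psum a * fps_deriv b"
    using b0 by (simp add: fps_compose_deriv)
  ultimately have "fps_X * fps_deriv (fps_of_psum a) = fps_of_psum a * - a"
    by (metis mult.left_commute)
  then have "a * fps_of_psum a = - (fps_X * fps_deriv (fps_of_psum a))"
    by (simp add: mult.commute)
  then show "psum (fps_of_psum a) = a"
    by (rule psum_eqI_mult[OF *])
qed

text \<open>The next two lemmas permit the replacement of a power series by a polynomial, which is a product
  of linear factors.\<close>

lemma psum_nth_cong:
  assumes f: "fps_nth f 0 = 1" "fps_nth f' 0 = 1"
    and eq: "\<And>k. k \<le> n \<Longrightarrow> fps_nth f k = fps_nth f' k" and "m \<le> n"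
  shows "fps_nth (psum f) m = fps_nth (psum f') m"
  using \<open>m \<le> n\<close>
proof (induction m rule: less_induct)
  case (less m)
  \<comment> \<open>Newton's identities: a power sum is determined by the earlier ones and by the
    coefficients of the series up to the same index.\<close>
  have *: "fps_nth (psum g) m + (\<Sum>i<m. fps_nth (psum g) i * fps_nth g (m - i)) = - (of_nat m * fps_nth g m)"
    if "fps_nth g 0 = 1" for g
  proof -
    have "fps_nth (psum g * g) m = - (of_nat m * fps_nth g m)"
      using psum_mult_self[OF that] by (cases m) (simp_all add: fps_X_mult_nth fps_deriv_nth)
    moreover have "fps_nth (psum g * g) m = (\<Sum>i<Suc m. fps_nth (psum g) i * fps_nth g (m - i))"
      by (simp only: fps_mult_nth atLeast0AtMost lessThan_Suc_atMost)
    ultimately show ?thesis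
      using that by (simp add: add.commute)
  qed
  have "(\<Sum>i<m. fps_nth (psum f) i * fps_nth f (m - i)) = (\<Sum>i<m. fps_nth (psum f') i * fps_nth f' (m - i))"
    using less by (intro sum.cong) (auto simp: eq)
  then show ?case
    using *[OF f(1)] *[OF f(2)] less.prems by (simp add: eq) (metis add_right_cancel)
qed

lemma fps_of_psum_nth_cong:
  assumes a: "fps_nth a 0 = 0" "fps_nth a' 0 = 0"
    and eq: "\<And>k. k \<le> n \<Longrightarrow> fps_nth a k = fps_nth a' k" and "m \<le> n"
  shows "fps_nth (fps_of_psum a) m = fps_nth (fps_of_psum a') m"
  using \<open>m \<le> n\<close>
proof (induction m rule: less_induct)
  case (less m)
  show ?case
  proof (cases "m = 0")
    case True
    then show ?thesis
      using a by (simp add: fps_of_psum_nth_0)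
  next
    case False
    \<comment> \<open>Newton's identities again, now solved for the coefficient of the series; this
      needs division by \<open>m\<close>, whence the separate case \<open>m = 0\<close>.\<close>
    have *: "of_nat m * fps_nth (fps_of_psum b) m = - (\<Sum>i<m. fps_nth (fps_of_psum b) i * fps_nth b (m - i))"
      if "fps_nth b 0 = 0" for b
    proof -
      have "fps_nth (fps_of_psum b * b) m = - (of_nat m * fps_nth (fps_of_psum b) m)"
        using psum_mult_self[OF fps_of_psum_nth_0[OF that]] False
        by (simp add: psum_fps_of_psum[OF that] fps_X_mult_nth fps_deriv_nth mult.commute)
      moreover have "fps_nth (fps_of_psum b * b) m = (\<Sum>i<Suc m. fps_nth (fps_of_psum b) i * fps_nth b (m - i))"
        by (simp only: fps_mult_nth atLeast0AtMost lessThan_Suc_atMost)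
      ultimately show ?thesis
        using that by simp
    qed
    have "(\<Sum>i<m. fps_nth (fps_of_psum a) i * fps_nth a (m - i)) =
        (\<Sum>i<m. fps_nth (fps_of_psum a') i * fps_nth a' (m - i))"
      using less by (intro sum.cong) (auto simp: eq)
    then have "of_nat m * fps_nth (fps_of_psum a) m = of_nat m * fps_nth (fps_of_psum a') m"
      using *[OF a(1)] *[OF a(2)] by simp
    then show ?thesis
      using False by simp
  qed
qed

lemma psum_linear:
  "psum (1 - fps_const u * fps_X) = Abs_fps (\<lambda>n. if n = 0 then 0 else u ^ n)"
proof (rule psum_eqI_mult)
  let ?g = "Abs_fps (\<lambda>n. if n = 0 then 0 else u ^ n)"
  have "?g * (1 - fps_const u * fps_X) = ?g - fps_const u * (fps_X * ?g)"
    by (simp add: algebra_simps)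
  also have "\<dots> = fps_const u * fps_X"
  proof (rule fps_ext)
    fix n
    show "fps_nth (?g - fps_const u * (fps_X * ?g)) n = fps_nth (fps_const u * fps_X) n"
      by (cases n; cases "n - 1") auto
  qed
  finally show "?g * (1 - fps_const u * fps_X) = - (fps_X * fps_deriv (1 - fps_const u * fps_X))"
    by (simp add: mult.commute)
qed simp

lemma fps_nth_prod_linear:
  fixes x :: "'i \<Rightarrow> complex"
  assumes "finite I"
  shows "fps_nth (\<Prod>i\<in>I. 1 + fps_const (x i) * fps_X) k = elem_sym k I x"
proof -
  have "(\<Prod>i\<in>I. 1 + fps_const (x i) * fps_X) = fps_of_poly (\<Prod>i\<in>I. [:1, x i:])"
    by (simp add: fps_of_poly_prod fps_of_poly_pCons mult.commute)
  then show ?thesis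
    using coeff_prod_one_plus[OF assms] by simp
qed

lemma elem_sym_uminus:
  fixes x :: "'i \<Rightarrow> 'r::comm_ring_1"
  shows "elem_sym n I (\<lambda>i. - x i) = (- 1) ^ n * elem_sym n I x"
proof -
  have "(\<Prod>i\<in>S. - x i) = (- 1) ^ card S * (\<Prod>i\<in>S. x i)" for S
    using prod.distrib[of "\<lambda>_. -1" x S] by simp
  then show ?thesis
    by (auto simp: elem_sym_def sum_distrib_left intro!: sum.cong)
qed

lemma ene_nth_0 [simp]: "fps_nth (f \<star> g) 0 = 1"
  by (simp add: ene_def)

lemma psum_prod_linear:
  "psum (\<Prod>i\<in>I. 1 + fps_const (x i) * fps_X) = Abs_fps (\<lambda>n. if n = 0 then 0 else \<Sum>i\<in>I. (- x i) ^ n)"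
proof -
  have "psum (\<Prod>i\<in>I. 1 - fps_const (- x i) * fps_X) = (\<Sum>i\<in>I. psum (1 - fps_const (- x i) * fps_X))"
    by (rule psum_prod) simp
  then have "psum (\<Prod>i\<in>I. 1 - fps_const (- x i) * fps_X) =
      Abs_fps (\<lambda>n. if n = 0 then 0 else \<Sum>i\<in>I. (- x i) ^ n)"
    unfolding psum_linear by (intro fps_ext) (simp add: fps_sum_nth)
  then show ?thesis
    by (simp flip: fps_const_neg)
qed

text \<open>The coefficient of index \<open>n\<close> depends only on the coefficients up to
  \<open>n\<close> of the factors. So \<open>f\<close> and \<open>g\<close> may be replaced by
  products of \<open>n\<close> linear factors, where the power sums of the products
  \<open>x_i y_j\<close> factor.\<close>

theorem psum_ene:
  assumes f: "fps_nth f 0 = 1" and g: "fps_nth g 0 = 1"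
  shows "psum (f \<star> g) = fps_hadamard (psum f) (psum g)"
proof -
  let ?h = "fps_of_psum (fps_hadamard (psum f) (psum g))"
  have "fps_nth (f \<star> g) n = fps_nth ?h n" for n
  proof (cases "n = 0")
    case False
    let ?I = "{1..n}"
    obtain x where x: "\<And>k. k \<in> {1..n} \<Longrightarrow> elem_sym k {1..n} x = fps_nth f k"
      using ex_elem_sym_eq by blast
    obtain y where y: "\<And>k. k \<in> {1..n} \<Longrightarrow> elem_sym k {1..n} y = fps_nth g k"
      using ex_elem_sym_eq by blast
    define f' where "f' = (\<Prod>i\<in>?I. 1 + fps_const (x i) * fps_X)"
    define g' where "g' = (\<Prod>i\<in>?I. 1 + fps_const (y i) * fps_X)"
    \<comment> \<open>The factors \<open>1 + x z\<close> have inverse zeros \<open>- x\<close>. The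
      product of two inverse zeros is therefore \<open>x y\<close>, which enters with a minus sign;
      this is the origin of the sign \<open>(- 1) ^ n\<close> in the definition of the
      product.\<close>
    define h' where "h' = (\<Prod>p\<in>?I \<times> ?I. 1 + fps_const (- (x (fst p) * y (snd p))) * fps_X)"
    have f': "fps_nth f' k = fps_nth f k" and g': "fps_nth g' k = fps_nth g k" if "k \<le> n" for k
      using that x[of k] y[of k] f g
      by (cases "k = 0"; simp add: f'_def g'_def fps_nth_prod_linear fps_nth_prod_0)+
    have f'0: "fps_nth f' 0 = 1" and g'0: "fps_nth g' 0 = 1" and h'0: "fps_nth h' 0 = 1"
      using f' g' f g by (simp_all add: h'_def fps_nth_prod_0)
    have "psum h' = fps_hadamard (psum f') (psum g')"
      unfolding f'_def g'_def h'_def psum_prod_linear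
      by (intro fps_ext)
        (auto simp: sum_product sum.cartesian_product case_prod_unfold power_mult_distrib [symmetric])
    then have "psum h' = psum (fps_of_psum (fps_hadamard (psum f') (psum g')))"
      by (simp add: psum_fps_of_psum)
    then have h': "h' = fps_of_psum (fps_hadamard (psum f') (psum g'))"
      by (rule psum_inject[OF h'0, rotated]) (simp add: fps_of_psum_nth_0)
    have "fps_nth (psum f') k = fps_nth (psum f) k" if "k \<le> n" for k
      using f' that by (rule psum_nth_cong[OF f'0 f])
    moreover have "fps_nth (psum g') k = fps_nth (psum g) k" if "k \<le> n" for k
      using g' that by (rule psum_nth_cong[OF g'0 g])
    ultimately have "fps_nth ?h n = fps_nth h' n"
      unfolding h' by (intro fps_of_psum_nth_cong[where n = n]) simp_all
    also have "\<dots> = (- 1) ^ n * elem_sym n (?I \<times> ?I) (\<lambda>(i, j). x i * y j)"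
      unfolding h'_def by (subst fps_nth_prod_linear) (simp_all add: elem_sym_uminus case_prod_unfold)
    also have "\<dots> = fps_nth (f \<star> g) n"
    proof -
      have "zpoly_subst (case_sum (fps_nth f) (fps_nth g)) (ene_poly n) =
          elem_sym n (?I \<times> ?I) (\<lambda>(i, j). x i * y j)"
        using False x y by (intro is_ene_poly_subst is_ene_poly_ene_poly) simp_all
      then show ?thesis
        using False by (simp add: ene_def)
    qed
    finally show ?thesis
      by simp
  qed (simp add: fps_of_psum_nth_0)
  then have "f \<star> g = ?h"
    by (rule fps_ext)
  then show ?thesis
    by (simp add: psum_fps_of_psum)
qed

section \<open>Multiplicativity, scaling and continuity of the product in its second factor\<close>

lemma ene_mult_right:
  assumes "fps_nth f 0 = 1" "fps_nth g 0 = 1" "fps_nth h 0 = 1"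
  shows "f \<star> (g * h) = (f \<star> g) * (f \<star> h)"
  by (rule psum_inject) (use assms in \<open>simp_all add: psum_ene psum_mult fps_eq_iff distrib_left\<close>)

lemma ene_1_right: "fps_nth f 0 = 1 \<Longrightarrow> f \<star> 1 = 1"
  by (rule psum_inject) (simp_all add: psum_ene fps_eq_iff)

lemma ene_prod_right:
  assumes "fps_nth f 0 = 1" "\<And>i. i \<in> A \<Longrightarrow> fps_nth (g i) 0 = 1"
  shows "f \<star> (\<Prod>i\<in>A. g i) = (\<Prod>i\<in>A. f \<star> g i)"
  using assms(2)
  by (induction A rule: infinite_finite_induct) (auto simp: ene_1_right ene_mult_right assms(1) fps_nth_prod_0)

lemma ene_power_right:
  assumes "fps_nth f 0 = 1" "fps_nth g 0 = 1"
  shows "f \<star> g ^ n = (f \<star> g) ^ n"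
  using ene_prod_right[of f "{..<n}" "\<lambda>_. g"] assms by simp

text \<open>The power sums of \<open>1 - u z\<close> are the powers of \<open>u\<close>, and
  multiplying the coefficients of \<open>psum f\<close> by them replaces \<open>z\<close> by
  \<open>u z\<close>.\<close>

lemma ene_linear_right:
  assumes "fps_nth f 0 = 1"
  shows "f \<star> (1 - fps_const u * fps_X) = f oo (fps_const u * fps_X)"
proof (rule psum_inject)
  let ?l = "fps_const u * fps_X"
  have "psum (f oo ?l) = psum f oo ?l"
  proof (rule psum_eqI_mult)
    have "(psum f oo ?l) * (f oo ?l) = (psum f * f) oo ?l"
      by (simp add: fps_compose_mult_distrib)
    also have "\<dots> = - (fps_X * fps_deriv (f oo ?l))"
      unfolding psum_mult_self[OF assms] fps_compose_linear
      by (intro fps_ext) (auto simp: fps_X_mult_nth fps_deriv_nth)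
    finally show "(psum f oo ?l) * (f oo ?l) = - (fps_X * fps_deriv (f oo ?l))" .
  qed (simp add: assms)
  also have "psum f oo ?l = fps_hadamard (psum f) (psum (1 - ?l))"
    unfolding fps_compose_linear psum_linear by (intro fps_ext) auto
  finally show "psum (f \<star> (1 - ?l)) = psum (f oo ?l)"
    using assms by (simp add: psum_ene)
qed (simp_all add: assms)

text \<open>Each coefficient of the product is a fixed polynomial in the coefficients of the
  factors, hence continuous in them.\<close>

lemma tendsto_ene_right:
  assumes "\<And>k. ((\<lambda>i. fps_nth (g i) k) \<longlongrightarrow> fps_nth h k) F"
  shows "((\<lambda>i. fps_nth (f \<star> g i) n) \<longlongrightarrow> fps_nth (f \<star> h) n) F"
proof -
  have "((\<lambda>i. case_sum (fps_nth f) (fps_nth (g i)) v) \<longlongrightarrow> case_sum (fps_nth f) (fps_nth h) v) F" for v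
    using assms by (cases v) auto
  then show ?thesis
    by (cases "n = 0") (auto simp: ene_def zpoly_subst_def intro!: tendsto_intros)
qed

section \<open>Growth of entire functions\<close>

lemma entire_eval_fps:
  assumes "fps_conv_radius f = \<infinity>"
  shows "eval_fps f holomorphic_on A" "eval_fps f analytic_on A" "continuous_on A (eval_fps f)"
    "eval_fps f has_fps_expansion f"
proof -
  show "eval_fps f holomorphic_on A" for A
    using assms by (intro holomorphic_on_eval_fps) (auto simp: eball_inf)
  then show "continuous_on A (eval_fps f)"
    by (intro holomorphic_on_imp_continuous_on)
  show "eval_fps f analytic_on A"
    using assms by (intro analytic_on_eval_fps) (auto simp: eball_inf)
  show "eval_fps f has_fps_expansion f"
    using assms by (intro eval_fps_has_fps_expansion) simp
qed

text \<open>The series \<open>f - 1\<close> is \<open>z\<close> times an entire function, and the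
  latter is bounded on the closed disk.\<close>

lemma eval_fps_linear_bound:
  fixes f :: "complex fps"
  assumes "fps_conv_radius f = \<infinity>" "fps_nth f 0 = 1"
  obtains K where "K \<ge> 0" "\<And>z. norm z \<le> R \<Longrightarrow> norm (eval_fps f z - 1) \<le> K * norm z"
proof -
  define g where "g = fps_shift 1 (f - 1)"
  have rad: "fps_conv_radius (f - 1) = \<infinity>"
    using fps_conv_radius_diff[of f 1] assms(1) by simp
  then have "fps_conv_radius g = \<infinity>"
    by (simp add: g_def)
  then have "compact (eval_fps g ` cball 0 R)"
    by (intro compact_continuous_image entire_eval_fps) auto
  then obtain K where K: "\<And>z. norm z \<le> R \<Longrightarrow> norm (eval_fps g z) \<le> K"
    by (force dest!: compact_imp_bounded simp: bounded_iff)
  show ?thesis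
  proof (rule that[of "max 0 K"])
    fix z :: complex assume z: "norm z \<le> R"
    have "f - 1 = fps_X * g"
    proof (rule fps_ext)
      fix n show "fps_nth (f - 1) n = fps_nth (fps_X * g) n"
        using assms(2) by (cases n) (auto simp: g_def)
    qed
    then have "eval_fps (f - 1) z = z * eval_fps g z"
      using \<open>fps_conv_radius g = \<infinity>\<close> by (simp add: eval_fps_mult)
    moreover have "eval_fps (f - 1) z = eval_fps f z - 1"
      using assms(1) by (subst eval_fps_diff) auto
    ultimately have "norm (eval_fps f z - 1) = norm z * norm (eval_fps g z)"
      by (metis norm_mult)
    also have "\<dots> \<le> norm z * max 0 K"
      using K[OF z] by (intro mult_left_mono) auto
    finally show "norm (eval_fps f z - 1) \<le> max 0 K * norm z"
      by (simp add: mult.commute)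
  qed simp
qed

section \<open>Order less than 1 in terms of exponential growth bounds\<close>

lemma norm_le_max_modulus:
  assumes "continuous_on UNIV f"
  shows "norm (f z) \<le> max_modulus f (norm z)"
proof -
  have "compact ((\<lambda>z. norm (f z)) ` sphere 0 (norm z))"
    using continuous_on_subset[OF assms] by (intro compact_continuous_image continuous_intros) auto
  then have "bdd_above ((\<lambda>z. norm (f z)) ` sphere 0 (norm z))"
    by (intro bounded_imp_bdd_above compact_imp_bounded)
  then show ?thesis
    unfolding max_modulus_def by (intro cSUP_upper) auto
qed

lemma norm_le_if_sphere:
  fixes f :: "complex \<Rightarrow> complex"
  assumes "f holomorphic_on UNIV" "norm z \<le> r" "\<And>w. norm w = r \<Longrightarrow> norm (f w) \<le> B"
  shows "norm (f z) \<le> B"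
proof (cases "r = 0")
  case False
  then have "r > 0"
    using assms(2) norm_ge_zero[of z] by linarith
  show ?thesis
    by (rule maximum_modulus_frontier[where S = "cball 0 r" and f = f])
      (use assms \<open>r > 0\<close> in \<open>auto intro: holomorphic_on_subset holomorphic_on_imp_continuous_on\<close>)
qed (use assms in auto)

text \<open>Outside a disk of radius \<open>R\<close> the limsup gives the bound with constant 1.
  Inside, \<open>f - 1\<close> is at most \<open>K |z|\<close>, which gives the constant
  \<open>K * R powr (1 - \<rho>)\<close>. No factor in front of the exponential remains, so the
  bound survives products over arbitrarily many zeros. All exponents from \<open>\<rho>0\<close> up
  to 1 are offered so that two functions can share one.\<close>

lemma entire_of_order_lt_1_growth:
  assumes "entire_of_order_lt_1 f" "fps_nth f 0 = 1"
  obtains \<rho>0 where "0 < \<rho>0" "\<rho>0 < 1"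
    "\<And>\<rho>. \<rho>0 \<le> \<rho> \<Longrightarrow> \<rho> < 1 \<Longrightarrow> \<exists>C\<ge>0. \<forall>z. norm (eval_fps f z) \<le> exp (C * norm z powr \<rho>)"
proof -
  let ?F = "eval_fps f"
  have rad: "fps_conv_radius f = \<infinity>" and "growth_order ?F < 1"
    using assms by (auto simp: entire_of_order_lt_1_def)
  then obtain a where a: "growth_order ?F < ereal a" "a < 1"
    using ereal_dense2[of "growth_order ?F" 1] by auto
  have "\<forall>\<^sub>F r in at_top. ereal (ln (ln (max_modulus ?F r)) / ln r) < ereal a"
    using a(1) unfolding growth_order_def by (rule Limsup_lessD)
  then obtain R0 where R0: "\<And>r. r \<ge> R0 \<Longrightarrow> ln (ln (max_modulus ?F r)) / ln r < a"
    by (auto simp: eventually_at_top_linorder)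
  define R where "R = max R0 2"
  have R: "R \<ge> 2" "R \<ge> R0"
    by (auto simp: R_def)
  obtain K where K: "K \<ge> 0" "\<And>z. norm z \<le> R \<Longrightarrow> norm (?F z - 1) \<le> K * norm z"
    using eval_fps_linear_bound[OF rad assms(2)] by blast
  show ?thesis
  \<comment> \<open>The maximum with \<open>1 / 2\<close> makes the exponent positive whatever
    \<open>a\<close> is.\<close>
  proof (rule that[of "max a (1 / 2)"])
    fix \<rho> assume \<rho>: "max a (1 / 2) \<le> \<rho>" "\<rho> < 1"
    define C where "C = max 1 (K * R powr (1 - \<rho>))"
    have "norm (?F z) \<le> exp (C * norm z powr \<rho>)" for z
    proof (cases "norm z \<le> R")
      case True
      have "norm (?F z) \<le> norm (?F z - 1) + 1"
        using norm_triangle_ineq[of "?F z - 1" 1] by simp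
      also have "\<dots> \<le> 1 + K * norm z"
        using K(2)[OF True] by simp
      also have "\<dots> \<le> exp (K * norm z)"
        by (rule exp_ge_add_one_self)
      also have "K * norm z \<le> K * (R powr (1 - \<rho>) * norm z powr \<rho>)"
      proof (rule mult_left_mono)
        have "norm z = norm z powr (1 - \<rho>) * norm z powr \<rho>"
          by (simp flip: powr_add)
        also have "\<dots> \<le> R powr (1 - \<rho>) * norm z powr \<rho>"
          using True \<rho> by (intro mult_right_mono powr_mono2) auto
        finally show "norm z \<le> R powr (1 - \<rho>) * norm z powr \<rho>" .
      qed (fact K(1))
      also have "\<dots> \<le> C * norm z powr \<rho>"
        unfolding mult.assoc[symmetric] by (intro mult_right_mono) (auto simp: C_def)
      finally show ?thesis
        by simp
    next
      case False
      let ?r = "norm z" and ?M = "max_modulus ?F (norm z)"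
      have r: "?r > 2"
        using False R by simp
      then have lnr: "ln ?r > 0"
        by (intro ln_gt_zero) simp
      have "norm (?F z) \<le> ?M"
        using entire_eval_fps[OF rad] by (intro norm_le_max_modulus)
      also have "?M \<le> exp (?r powr \<rho>)"
      \<comment> \<open>For \<open>?M \<le> 1\<close> the inner logarithm is not positive, and the
        estimate of \<open>ln (ln ?M)\<close> carries no information.\<close>
      proof (cases "?M \<le> 1")
        case True
        also have "1 \<le> exp (?r powr \<rho>)"
          by simp
        finally show ?thesis .
      next
        case M: False
        have "ln (ln ?M) < a * ln ?r"
          using R0[of ?r] False R \<open>ln ?r > 0\<close> by (simp add: pos_divide_less_eq)
        also have "\<dots> \<le> \<rho> * ln ?r"
          using \<rho> \<open>ln ?r > 0\<close> by (intro mult_right_mono) auto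
        finally have "exp (ln (ln ?M)) < exp (\<rho> * ln ?r)"
          by simp
        then have "ln ?M < ?r powr \<rho>"
          using M r by (cases "z = 0") (auto simp: powr_def)
        then have "exp (ln ?M) \<le> exp (?r powr \<rho>)"
          by simp
        then show ?thesis
          using M by simp
      qed
      also have "\<dots> \<le> exp (C * ?r powr \<rho>)"
        using mult_right_mono[of 1 C "?r powr \<rho>"] by (simp add: C_def)
      finally show ?thesis .
    qed
    moreover have "C \<ge> 0"
      by (simp add: C_def)
    ultimately show "\<exists>C\<ge>0. \<forall>z. norm (?F z) \<le> exp (C * norm z powr \<rho>)"
      by blast
  qed (use a in auto)
qed

text \<open>Value 1 at the origin and the maximum principle keep the maximum modulus at least 1, so
  its logarithm is nonnegative. Dividing \<open>ln E + \<rho> * ln r\<close> by \<open>ln r\<close>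
  leaves \<open>\<rho>\<close> in the limit.\<close>

lemma growth_imp_entire_of_order_lt_1:
  assumes rad: "fps_conv_radius f = \<infinity>" and "fps_nth f 0 = 1" and \<rho>: "0 \<le> \<rho>" "\<rho> < 1"
    and bound: "\<And>z. norm (eval_fps f z) \<le> D * exp (C * norm z powr \<rho>)"
  shows "entire_of_order_lt_1 f"
proof -
  let ?F = "eval_fps f"
  define E where "E = ln (max 1 D) + max 1 C"
  have E: "E \<ge> 1"
    using ln_ge_zero[of "max 1 D"] max.cobounded1[of 1 C] max.cobounded1[of 1 D] unfolding E_def by linarith
  have M: "1 \<le> max_modulus ?F r \<and> ln (max_modulus ?F r) \<le> E * r powr \<rho>" if "r \<ge> 1" for r
  proof
    have "norm (?F w) \<le> max_modulus ?F r" if "norm w = r" for w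
      using norm_le_max_modulus[OF entire_eval_fps(3)[OF rad], of w] that by simp
    with that have "norm (?F 0) \<le> max_modulus ?F r"
      using norm_le_if_sphere[OF entire_eval_fps(1)[OF rad], of 0 r "max_modulus ?F r"] by simp
    then show ge: "1 \<le> max_modulus ?F r"
      using assms(2) by (simp add: eval_fps_at_0)
    have "max_modulus ?F r \<le> D * exp (C * r powr \<rho>)"
      unfolding max_modulus_def
    proof (rule cSUP_least)
      show "sphere 0 r \<noteq> ({} :: complex set)"
        using that by simp
    qed (use bound in fastforce)
    also have "\<dots> \<le> max 1 D * exp (max 1 C * r powr \<rho>)"
      by (intro mult_mono) (auto intro!: mult_right_mono)
    finally have "ln (max_modulus ?F r) \<le> ln (max 1 D * exp (max 1 C * r powr \<rho>))"
      using ge by (subst ln_le_cancel_iff) auto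
    also have "\<dots> = ln (max 1 D) * 1 + max 1 C * r powr \<rho>"
      by (simp add: ln_mult)
    also have "\<dots> \<le> ln (max 1 D) * r powr \<rho> + max 1 C * r powr \<rho>"
      using that \<rho> by (intro add_right_mono mult_left_mono ge_one_powr_ge_zero) auto
    finally show "ln (max_modulus ?F r) \<le> E * r powr \<rho>"
      by (simp add: E_def algebra_simps)
  qed
  obtain \<tau> where \<tau>: "\<rho> < \<tau>" "\<tau> < 1"
    using dense[OF \<rho>(2)] by blast
  have "((\<lambda>r. ln E / ln r + \<rho>) \<longlongrightarrow> 0 + \<rho>) at_top"
    by (intro tendsto_intros) real_asymp
  then have "\<forall>\<^sub>F r in at_top. ln E / ln r + \<rho> < \<tau>"
    using \<tau> by (intro order_tendstoD(2)) auto
  then have "\<forall>\<^sub>F r in at_top. ereal (ln (ln (max_modulus ?F r)) / ln r) \<le> ereal \<tau>"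
    using eventually_gt_at_top[of 1]
  proof eventually_elim
    case (elim r)
    have "ln (ln (max_modulus ?F r)) \<le> ln E + \<rho> * ln r"
    \<comment> \<open>In the first case the outer logarithm takes its default value
      \<open>ln 0 = 0\<close>.\<close>
    proof (cases "ln (max_modulus ?F r) = 0")
      case True
      then show ?thesis
        using E elim \<rho> by simp
    next
      case False
      then have "ln (max_modulus ?F r) > 0"
        using M[of r] elim by (simp add: less_le)
      then have "ln (ln (max_modulus ?F r)) \<le> ln (E * r powr \<rho>)"
        using M[of r] elim E by (subst ln_le_cancel_iff) auto
      then show ?thesis
        using E elim by (simp add: ln_mult ln_powr)
    qed
    then have "ln (ln (max_modulus ?F r)) / ln r \<le> (ln E + \<rho> * ln r) / ln r"
      using elim by (intro divide_right_mono) auto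
    also have "\<dots> = ln E / ln r + \<rho>"
      using elim by (simp add: add_divide_distrib)
    finally show ?case
      using elim by simp
  qed
  then have "growth_order ?F \<le> ereal \<tau>"
    unfolding growth_order_def by (rule Limsup_bounded)
  also have "\<dots> < 1"
    using \<tau> by simp
  finally show ?thesis
    using rad by (simp add: entire_of_order_lt_1_def)
qed

section \<open>Coefficient bounds and growth\<close>

lemma fps_nth_bound:
  assumes "F has_fps_expansion f" "F holomorphic_on cball 0 s" "s > 0"
    and "\<And>z. norm z = s \<Longrightarrow> norm (F z) \<le> B"
  shows "norm (fps_nth f n) \<le> B / s ^ n"
proof -
  have "norm ((deriv ^^ n) F 0) \<le> fact n * B / s ^ n"
  proof (rule Cauchy_inequality)
    show "F holomorphic_on ball 0 s" "continuous_on (cball 0 s) F"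
      using assms(2) by (auto intro: holomorphic_on_subset holomorphic_on_imp_continuous_on)
  qed (use assms in auto)
  then show ?thesis
    by (simp add: fps_nth_fps_expansion[OF assms(1)] norm_divide field_simps)
qed

text \<open>The coefficient bound at \<open>s = 2 |z|\<close> dominates the series at
  \<open>z\<close> by a geometric series of ratio \<open>1 / 2\<close>. The doubled radius affects
  only the constant in the exponent.\<close>

lemma coeff_bound_imp_entire:
  fixes f :: "complex fps"
  assumes "fps_nth f 0 = 1" and bound: "\<And>n s. s > 0 \<Longrightarrow> norm (fps_nth f n) \<le> exp (C * s powr \<rho>) / s ^ n"
  shows "fps_conv_radius f = \<infinity>"
    and "norm (eval_fps f z) \<le> 2 * exp (C * (2 * norm z) powr \<rho>)"
proof -
  have *: "norm (fps_nth f n * z ^ n) \<le> exp (C * (2 * norm z) powr \<rho>) * (1 / 2) ^ n" for n z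
  proof (cases "z = 0")
    case True
    then show ?thesis
      using assms(1) by (cases n) auto
  next
    case False
    have "norm (fps_nth f n) * norm z ^ n \<le> exp (C * (2 * norm z) powr \<rho>) / (2 * norm z) ^ n * norm z ^ n"
      using False by (intro mult_right_mono bound) auto
    then show ?thesis
      using False by (simp add: norm_mult norm_power power_mult_distrib power_divide)
  qed
  have geo: "(\<lambda>n. c * (1 / 2) ^ n) sums (c * 2)" for c :: real
    using geometric_sums[of "1 / 2 :: real"] by (intro sums_mult) simp
  have summ: "summable (\<lambda>n. norm (fps_nth f n * z ^ n))" for z
    by (rule summable_comparison_test[OF _ sums_summable[OF geo]]) (use * in auto)
  show "fps_conv_radius f = \<infinity>"
    unfolding fps_conv_radius_def by (rule conv_radius_inftyI'', rule summable_norm_cancel, rule summ)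
  have "norm (eval_fps f z) \<le> suminf (\<lambda>n. norm (fps_nth f n * z ^ n))"
    unfolding eval_fps_def by (rule summable_norm[OF summ])
  also have "\<dots> \<le> suminf (\<lambda>n. exp (C * (2 * norm z) powr \<rho>) * (1 / 2) ^ n)"
    by (intro suminf_le summ sums_summable[OF geo] *)
  also have "\<dots> = 2 * exp (C * (2 * norm z) powr \<rho>)"
    using sums_unique[OF geo] by (metis mult.commute)
  finally show "norm (eval_fps f z) \<le> 2 * exp (C * (2 * norm z) powr \<rho>)" .
qed

text \<open>Induction on \<open>a P - 1 = a (P - 1) + (a - 1)\<close>, where
  \<open>|a| \<le> exp t\<close>. Bounds of the form \<open>exp t - 1\<close> combine into one with
  the sum of the exponents.\<close>

lemma norm_prod_minus_1_le:
  fixes a :: "'i \<Rightarrow> complex"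
  assumes "\<And>i. i \<in> I \<Longrightarrow> norm (a i - 1) \<le> exp (t i) - 1"
  shows "norm ((\<Prod>i\<in>I. a i) - 1) \<le> exp (\<Sum>i\<in>I. t i) - 1"
  using assms
proof (induction I rule: infinite_finite_induct)
  case (insert i I)
  let ?P = "\<Prod>i\<in>I. a i"
  have "norm (a i) \<le> exp (t i)"
    using insert.prems[of i] norm_triangle_ineq[of "a i - 1" 1] by simp
  have "norm (a i * ?P - 1) \<le> norm (a i * (?P - 1)) + norm (a i - 1)"
    using norm_triangle_ineq[of "a i * (?P - 1)" "a i - 1"] by (simp add: algebra_simps)
  also have "\<dots> \<le> exp (t i) * (exp (\<Sum>i\<in>I. t i) - 1) + (exp (t i) - 1)"
    unfolding norm_mult using insert \<open>norm (a i) \<le> exp (t i)\<close> by (intro add_mono mult_mono) auto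
  finally show ?case
    using insert by (simp add: exp_add algebra_simps)
qed auto

lemma norm_power_minus_1_le:
  fixes a :: complex
  shows "norm (a ^ m - 1) \<le> exp (of_nat m * norm (a - 1)) - 1"
  using norm_prod_minus_1_le[of "{..<m}" "\<lambda>_. a" "\<lambda>_. norm (a - 1)"]
    exp_ge_add_one_self[of "norm (a - 1)"] by simp

text \<open>This is the Schwarz lemma for \<open>g / (2 A - g)\<close>.\<close>

lemma Borel_Caratheodory:
  assumes g: "g holomorphic_on ball 0 R" "g 0 = 0" and Re: "\<And>z. norm z < R \<Longrightarrow> Re (g z) < A"
    and z: "norm z < R"
  shows "norm (g z) \<le> 2 * A * norm z / (R - norm z)"
proof -
  have R: "R > 0"
    using z norm_ge_zero[of z] by linarith
  have A: "A > 0"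
    using Re[of 0] g R by simp
  \<comment> \<open>Real part below \<open>A\<close> means that \<open>g w\<close> is closer to 0
    than to \<open>2 A\<close>, so the quotient maps into the unit disk.\<close>
  have lt: "norm (g w) < norm (of_real (2 * A) - g w)" if "norm w < R" for w
  proof -
    have "(norm (g w))\<^sup>2 = Re (g w) ^ 2 + Im (g w) ^ 2"
      by (rule cmod_power2)
    also have "\<dots> < (2 * A - Re (g w)) ^ 2 + Im (g w) ^ 2"
    proof -
      have "(2 * A - Re (g w)) ^ 2 - Re (g w) ^ 2 = 4 * A * (A - Re (g w))"
        by (simp add: power2_eq_square algebra_simps)
      moreover have "4 * A * (A - Re (g w)) > 0"
        using A Re[OF that] by simp
      ultimately show ?thesis
        by simp
    qed
    also have "\<dots> = (norm (of_real (2 * A) - g w))\<^sup>2"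
      by (simp add: cmod_power2)
    finally show ?thesis
      by (rule power2_less_imp_less) simp
  qed
  define \<phi> where "\<phi> w = g (of_real R * w) / (of_real (2 * A) - g (of_real R * w))" for w
  have in_ball: "norm (of_real R * w) < R" if "norm w < 1" for w :: complex
    using that R by (simp add: norm_mult)
  have nz: "of_real (2 * A) - g (of_real R * w) \<noteq> 0" if "norm w < 1" for w
    using lt[OF in_ball[OF that]] by (metis norm_not_less_zero norm_zero)
  have hol: "(\<lambda>w. g (of_real R * w)) holomorphic_on ball 0 1"
    using in_ball
    by (intro holomorphic_on_compose_gen[OF _ g(1), unfolded o_def] holomorphic_intros) auto
  define w where "w = z / of_real R"
  have w: "norm w < 1" "of_real R * w = z" "norm w = norm z / R"
    using z R by (auto simp: w_def norm_divide)
  have "norm (\<phi> w) \<le> norm w"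
  proof (rule Schwarz_Lemma(1))
    show "\<phi> holomorphic_on ball 0 1"
      unfolding \<phi>_def using nz by (intro holomorphic_intros hol) auto
    show "\<phi> 0 = 0"
      using g by (simp add: \<phi>_def)
    show "norm (\<phi> w) < 1" if "norm w < 1" for w
      using lt[OF in_ball[OF that]] nz[OF that] by (simp add: \<phi>_def norm_divide divide_simps)
  qed (fact w)
  then have "norm (g z) \<le> norm z / R * norm (of_real (2 * A) - g z)"
    using nz[OF w(1)] w by (simp add: \<phi>_def norm_divide divide_simps split: if_splits)
  also have "\<dots> \<le> norm z / R * (2 * A + norm (g z))"
    using R A norm_triangle_ineq4[of "of_real (2 * A)" "g z"] by (intro mult_left_mono) auto
  finally have "norm (g z) * (R - norm z) \<le> 2 * A * norm z"
    using R by (simp add: field_simps)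
  then show ?thesis
    using z by (simp add: pos_le_divide_eq)
qed

section \<open>Zeros of entire functions of order less than 1\<close>

lemma norm_exp_minus_1_le:
  fixes z :: complex
  shows "norm (exp z - 1) \<le> exp (norm z) - 1"
proof -
  let ?c = "\<lambda>n. inverse (fact (Suc n)) *\<^sub>R z ^ Suc n"
  have norm_c: "norm (?c n) = inverse (fact (Suc n)) *\<^sub>R norm z ^ Suc n" for n
    by (simp add: norm_mult norm_power)
  have "summable (\<lambda>n. norm (?c n))"
    using summable_norm_exp[of z, THEN summable_ignore_initial_segment, of 1] by simp
  then have "norm (suminf ?c) \<le> (suminf (\<lambda>n. norm (?c n)))"
    by (rule summable_norm)
  then show ?thesis
    unfolding norm_c using exp_first_term[of z] exp_first_term[of "norm z"] by simp
qed

lemma entire_imp_analytic: "h holomorphic_on UNIV \<Longrightarrow> h analytic_on A"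
  using analytic_on_open[of UNIV h] analytic_on_subset[of h UNIV A] by simp

lemma entire_eventually_nonzero:
  assumes "h holomorphic_on UNIV" "h a \<noteq> 0"
  shows "\<forall>\<^sub>F w in at z. h w \<noteq> 0"
  using non_zero_neighbour_alt[of h UNIV z a] assms by auto

text \<open>Off \<open>b\<close> the quotient by the power of \<open>z - b\<close> is holomorphic,
  and near \<open>b\<close> it agrees with \<open>zor_poly\<close>; the two pieces glue to an entire
  function.\<close>

lemma entire_factor_zero:
  assumes h: "h holomorphic_on UNIV" "h a \<noteq> 0"
  obtains k where "k holomorphic_on UNIV" "\<And>z. h z = (z - b) ^ nat (zorder h b) * k z" "k b \<noteq> 0"
proof -
  have an: "h analytic_on {b}" and nz: "\<exists>\<^sub>F w in at b. h w \<noteq> 0"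
    using entire_imp_analytic[OF h(1)] entire_eventually_nonzero[OF h, of b]
    by (auto intro: eventually_frequently)
  show ?thesis
  proof (cases "h b = 0")
    case False
    then have "zorder h b = 0"
      using zorder_eq_0_iff[OF an nz] by simp
    then show ?thesis
      using that[of h] h False by simp
  next
    case True
    define n where "n = nat (zorder h b)"
    have n: "zorder h b = int n" "n > 0"
      using zorder_pos_iff'[OF an nz] True by (auto simp: n_def)
    have "isolated_singularity_at h b" "not_essential h b"
      using an by (auto intro: isolated_singularity_at_analytic not_essential_analytic)
    from zorder_exist[OF this nz] obtain r where r: "r > 0" "zor_poly h b holomorphic_on cball b r"
      "\<And>w. w \<in> cball b r - {b} \<Longrightarrow> h w = zor_poly h b w * (w - b) ^ n" "zor_poly h b b \<noteq> 0"
      by (auto simp: n)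
    define k where "k w = (if w = b then zor_poly h b b else h w / (w - b) ^ n)" for w
    have "k holomorphic_on (- {b}) \<union> ball b r"
    proof (rule holomorphic_on_Un)
      have "(\<lambda>w. h w / (w - b) ^ n) holomorphic_on - {b}"
        using h by (intro holomorphic_intros) (auto intro: holomorphic_on_subset)
      then show "k holomorphic_on - {b}"
        by (rule holomorphic_transform) (auto simp: k_def)
      have "zor_poly h b holomorphic_on ball b r"
        using r(2) by (rule holomorphic_on_subset) auto
      then show "k holomorphic_on ball b r"
        by (rule holomorphic_transform) (auto simp: k_def r(3))
    qed auto
    moreover have "(- {b}) \<union> ball b r = UNIV"
      using r(1) by auto
    ultimately show ?thesis
      using that[of k] r(4) n(2) True by (auto simp: k_def n_def [symmetric])
  qed
qed

text \<open>The zeros are removed one at a time. The factors already split off do not vanish at the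
  next point \<open>b\<close>, so the cofactor has the same order there as \<open>g\<close>.\<close>

lemma entire_factor_zeros:
  assumes g: "g holomorphic_on UNIV" "g 0 \<noteq> 0" and Z: "finite Z" "0 \<notin> Z"
  obtains h where "h holomorphic_on UNIV" "\<And>z. g z = (\<Prod>b\<in>Z. (1 - z / b) ^ nat (zorder g b)) * h z"
    "\<And>b. b \<in> Z \<Longrightarrow> h b \<noteq> 0"
proof -
  have "\<exists>h. h holomorphic_on UNIV \<and> (\<forall>z. g z = (\<Prod>b\<in>Z. (1 - z / b) ^ nat (zorder g b)) * h z) \<and>
      (\<forall>b\<in>Z. h b \<noteq> 0)"
    using Z
  proof (induction Z rule: finite_induct)
    case empty
    then show ?case
      using g by auto
  next
    case (insert b Z)
    then obtain h where h: "h holomorphic_on UNIV" "\<And>z. g z = (\<Prod>b\<in>Z. (1 - z / b) ^ nat (zorder g b)) * h z"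
      "\<And>b. b \<in> Z \<Longrightarrow> h b \<noteq> 0"
      by auto
    define p where "p z = (\<Prod>b\<in>Z. (1 - z / b) ^ nat (zorder g b))" for z
    have hol_p: "p holomorphic_on UNIV"
      unfolding p_def using insert.prems by (intro holomorphic_intros) auto
    have "p b \<noteq> 0"
      using insert by (auto simp: p_def)
    have "h 0 \<noteq> 0"
      using h(2)[of 0] g(2) by auto
    have an: "f analytic_on {b}" if "f holomorphic_on UNIV" for f
      using that by (rule entire_imp_analytic)
    have g_eq: "g = (\<lambda>z. p z * h z)"
      using h(2) by (auto simp: p_def)
    have "zorder g b = zorder p b + zorder h b"
      unfolding g_eq
    proof (rule zorder_times_analytic)
      show "\<forall>\<^sub>F z in at b. p z * h z \<noteq> 0"
        using entire_eventually_nonzero[OF g, of b] by (simp add: g_eq)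
    qed (use hol_p h an in auto)
    moreover have "zorder p b = 0"
      using an[OF hol_p] \<open>p b \<noteq> 0\<close> by (rule zorder_eq_0I)
    ultimately have ord: "zorder h b = zorder g b"
      by simp
    define m where "m = nat (zorder g b)"
    obtain k where k: "k holomorphic_on UNIV" "\<And>z. h z = (z - b) ^ m * k z" "k b \<noteq> 0"
      using entire_factor_zero[OF h(1) \<open>h 0 \<noteq> 0\<close>, of b] unfolding ord m_def by blast
    have "b \<noteq> 0"
      using insert by auto
    have eq: "g z = (\<Prod>b\<in>insert b Z. (1 - z / b) ^ nat (zorder g b)) * ((- b) ^ m * k z)" for z
    proof -
      \<comment> \<open>The constant \<open>(- b) ^ m\<close> converts the factor to value 1 at the
        origin and is absorbed into the cofactor.\<close>
      have "(z - b) ^ m = (1 - z / b) ^ m * (- b) ^ m"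
        using \<open>b \<noteq> 0\<close> by (simp flip: power_mult_distrib add: field_simps)
      then show ?thesis
        using insert by (simp add: h(2) k(2) m_def mult_ac)
    qed
    have "\<forall>c\<in>insert b Z. (- b) ^ m * k c \<noteq> 0"
      using h(3) k(2,3) \<open>b \<noteq> 0\<close> by auto
    moreover have "(\<lambda>z. (- b) ^ m * k z) holomorphic_on UNIV"
      by (intro holomorphic_intros k(1))
    ultimately show ?case
      using eq by blast
  qed
  then show ?thesis
    using that by blast
qed

section \<open>Counting zeros and approximation by finite products over them\<close>

definition zeros_in :: "complex fps \<Rightarrow> real \<Rightarrow> complex set" where
  "zeros_in g r = {b. eval_fps g b = 0 \<and> norm b \<le> r}"

definition mult_at :: "complex fps \<Rightarrow> complex \<Rightarrow> nat" where
  "mult_at g b = nat (zorder (eval_fps g) b)"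

definition zero_prod :: "complex fps \<Rightarrow> real \<Rightarrow> complex fps" where
  "zero_prod g r = (\<Prod>b\<in>zeros_in g r. (1 - fps_const (1 / b) * fps_X) ^ mult_at g b)"

lemma zero_prod_expansion:
  "(\<lambda>z. \<Prod>b\<in>zeros_in g r. (1 - z / b) ^ mult_at g b) has_fps_expansion zero_prod g r"
proof -
  have "(\<lambda>z. \<Prod>b\<in>zeros_in g r. (1 - 1 / b * z) ^ mult_at g b) has_fps_expansion zero_prod g r"
    unfolding zero_prod_def by (intro fps_expansion_intros)
  then show ?thesis
    by simp
qed

lemma zero_prod_nth_0 [simp]: "fps_nth (zero_prod g r) 0 = 1"
  by (simp add: zero_prod_def fps_nth_prod_0 fps_nth_power_0)

context
  fixes g :: "complex fps"
  assumes rad: "fps_conv_radius g = \<infinity>" and g0: "fps_nth g 0 = 1"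
begin

lemma eval_fps_0_eq_1: "eval_fps g 0 = 1"
  using g0 by (simp add: eval_fps_at_0)

lemma finite_zeros_in: "finite (zeros_in g r)"
proof (cases "eval_fps g constant_on UNIV")
  case True
  then have "eval_fps g z = eval_fps g 0" for z
    unfolding constant_on_def by (metis UNIV_I)
  then have "zeros_in g r = {}"
    using eval_fps_0_eq_1 by (auto simp: zeros_in_def)
  then show ?thesis
    by simp
next
  case False
  have "finite {z \<in> cball 0 r. eval_fps g z = 0}"
    by (rule holomorphic_compact_finite_zeros[OF entire_eval_fps(1)[OF rad, of UNIV]]) (use False in auto)
  then show ?thesis
    by (rule rev_finite_subset) (auto simp: zeros_in_def)
qed

lemma zero_notin_zeros_in: "0 \<notin> zeros_in g r"
  using eval_fps_0_eq_1 by (auto simp: zeros_in_def)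

text \<open>On the circle of radius \<open>3 r\<close> every factor \<open>1 - z / b\<close> with
  \<open>|b| \<le> r\<close> has modulus at least 2. Dividing the growth bound by these factors
  bounds the cofactor on the circle, and the maximum principle carries the bound inside.\<close>

lemma zero_prod_factor:
  assumes bound: "\<And>z. norm (eval_fps g z) \<le> exp (C * norm z powr \<rho>)" and "r > 0"
  obtains h where "h holomorphic_on UNIV" "h 0 = 1" "\<And>z. norm z \<le> r \<Longrightarrow> h z \<noteq> 0"
    "\<And>z. eval_fps g z = (\<Prod>b\<in>zeros_in g r. (1 - z / b) ^ mult_at g b) * h z"
    "\<And>z. norm z \<le> 3 * r \<Longrightarrow> 2 ^ (\<Sum>b\<in>zeros_in g r. mult_at g b) * norm (h z) \<le> exp (C * (3 * r) powr \<rho>)"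
proof -
  let ?p = "\<lambda>z. \<Prod>b\<in>zeros_in g r. (1 - z / b) ^ mult_at g b"
  let ?N = "\<Sum>b\<in>zeros_in g r. mult_at g b"
  obtain h where h: "h holomorphic_on UNIV" "\<And>z. eval_fps g z = ?p z * h z"
    "\<And>b. b \<in> zeros_in g r \<Longrightarrow> h b \<noteq> 0"
    using entire_factor_zeros[OF entire_eval_fps(1)[OF rad] _ finite_zeros_in zero_notin_zeros_in] eval_fps_0_eq_1
    unfolding mult_at_def by (metis zero_neq_one)
  have h0: "h 0 = 1"
    using h(2)[of 0] eval_fps_0_eq_1 by simp
  have nz: "h z \<noteq> 0" if "norm z \<le> r" for z
    using that h(2)[of z] h(3)[of z] by (auto simp: zeros_in_def)
  have "norm (h z) \<le> exp (C * (3 * r) powr \<rho>) / 2 ^ ?N" if z: "norm z \<le> 3 * r" for z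
  proof (rule norm_le_if_sphere[OF h(1) z])
    fix w :: complex assume w: "norm w = 3 * r"
    have ge: "2 \<le> norm (1 - w / b)" if "b \<in> zeros_in g r" for b
    proof -
      have b: "b \<noteq> 0" "norm b \<le> r"
        using that zero_notin_zeros_in by (auto simp: zeros_in_def)
      then have "3 \<le> norm (w / b)"
        using w \<open>r > 0\<close> by (simp add: norm_divide divide_simps)
      then show ?thesis
        using norm_triangle_ineq2[of "w / b" 1] by (simp add: norm_minus_commute)
    qed
    have "2 ^ ?N * norm (h w) = (\<Prod>b\<in>zeros_in g r. 2 ^ mult_at g b) * norm (h w)"
      by (simp add: power_sum)
    also have "\<dots> \<le> norm (?p w) * norm (h w)"
      unfolding prod_norm [symmetric] norm_power
      by (intro mult_right_mono prod_mono conjI power_mono ge) auto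
    also have "\<dots> = norm (eval_fps g w)"
      by (simp add: h(2) norm_mult)
    also have "\<dots> \<le> exp (C * (3 * r) powr \<rho>)"
      using bound[of w] w by simp
    finally show "norm (h w) \<le> exp (C * (3 * r) powr \<rho>) / 2 ^ ?N"
      by (simp add: field_simps)
  qed
  then show ?thesis
    using that[OF h(1) h0 nz h(2)] by (simp add: field_simps)
qed

text \<open>A bound in the manner of Jensen: the estimate of the cofactor is read at the origin,
  where its value is 1.\<close>

lemma count_zeros_le:
  assumes bound: "\<And>z. norm (eval_fps g z) \<le> exp (C * norm z powr \<rho>)" and "r > 0"
  shows "real (\<Sum>b\<in>zeros_in g r. mult_at g b) \<le> C * 3 powr \<rho> / ln 2 * r powr \<rho>"
proof -
  let ?N = "\<Sum>b\<in>zeros_in g r. mult_at g b"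
  have "2 ^ ?N \<le> exp (C * (3 * r) powr \<rho>)"
  proof (rule zero_prod_factor[OF assms])
    fix h :: "complex \<Rightarrow> complex"
    assume "h 0 = 1" "\<And>z. norm z \<le> 3 * r \<Longrightarrow> 2 ^ ?N * norm (h z) \<le> exp (C * (3 * r) powr \<rho>)"
    from this(1) this(2)[of 0] show ?thesis
      using \<open>r > 0\<close> by simp
  qed
  then have "ln (2 ^ ?N) \<le> ln (exp (C * (3 * r) powr \<rho>))"
    by (subst ln_le_cancel_iff) auto
  then have "real ?N * ln 2 \<le> C * (3 powr \<rho> * r powr \<rho>)"
    using \<open>r > 0\<close> by (simp add: ln_realpow powr_mult)
  then show ?thesis
    by (simp add: field_simps)
qed

text \<open>Dyadic shells: zeros with \<open>2^k < |b| \<le> 2^(k+1)\<close> number at most a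
  constant times \<open>2 powr (k * \<rho>)\<close> and contribute at most
  \<open>2 powr (- k * \<rho>')\<close> each. The shells sum to a geometric series because
  \<open>\<rho> < \<rho>'\<close>.\<close>

lemma sum_zeros_bounded:
  assumes bound: "\<And>z. norm (eval_fps g z) \<le> exp (C * norm z powr \<rho>)" and "C \<ge> 0" and \<rho>: "\<rho> < \<rho>'" "0 < \<rho>'"
  obtains B where "B \<ge> 0" "\<And>r. (\<Sum>b\<in>zeros_in g r. real (mult_at g b) * norm b powr (- \<rho>')) \<le> B"
proof -
  define T where "T r = (\<Sum>b\<in>zeros_in g r. real (mult_at g b) * norm b powr (- \<rho>'))" for r
  define N where "N = C * 3 powr \<rho> / ln 2"
  define q :: real where "q = 2 powr (\<rho> - \<rho>')"
  have N: "N \<ge> 0"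
    using \<open>C \<ge> 0\<close> by (simp add: N_def)
  have q: "0 < q" "q < 1"
    using \<rho> powr_less_mono[of "\<rho> - \<rho>'" 0 2] by (auto simp: q_def)
  have T_mono: "T r \<le> T s" if "r \<le> s" for r s
    unfolding T_def using that by (intro sum_mono2 finite_zeros_in) (auto simp: zeros_in_def)
  have step: "T (2 ^ Suc k) \<le> T (2 ^ k) + N * 2 powr \<rho> * q ^ k" for k
  proof -
    let ?D = "zeros_in g (2 ^ Suc k) - zeros_in g (2 ^ k)"
    have sub: "zeros_in g (2 ^ k) \<subseteq> zeros_in g (2 ^ Suc k)"
      by (auto simp: zeros_in_def intro: order_trans)
    have "T (2 ^ Suc k) = T (2 ^ k) + (\<Sum>b\<in>?D. real (mult_at g b) * norm b powr (- \<rho>'))"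
      unfolding T_def by (subst add.commute, rule sum.subset_diff[OF sub finite_zeros_in])
    also have "(\<Sum>b\<in>?D. real (mult_at g b) * norm b powr (- \<rho>')) \<le>
        (\<Sum>b\<in>?D. real (mult_at g b) * (2 ^ k) powr (- \<rho>'))"
      using \<rho> by (intro sum_mono mult_left_mono powr_mono2') (auto simp: zeros_in_def)
    also have "\<dots> \<le> (\<Sum>b\<in>zeros_in g (2 ^ Suc k). real (mult_at g b) * (2 ^ k) powr (- \<rho>'))"
      by (intro sum_mono2 finite_zeros_in) auto
    also have "\<dots> = real (\<Sum>b\<in>zeros_in g (2 ^ Suc k). mult_at g b) * (2 ^ k) powr (- \<rho>')"
      by (simp add: sum_distrib_right)
    also have "\<dots> \<le> N * (2 ^ Suc k) powr \<rho> * (2 ^ k) powr (- \<rho>')"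
      using count_zeros_le[OF bound, of "2 ^ Suc k"] by (intro mult_right_mono) (auto simp: N_def)
    also have "\<dots> = N * 2 powr \<rho> * q ^ k"
      by (simp add: q_def powr_mult powr_diff powr_minus powr_powr powr_realpow [symmetric] divide_simps
          power_divide mult_ac)
    finally show ?thesis
      by simp
  qed
  have "T (2 ^ k) \<le> T 1 + N * 2 powr \<rho> * (1 / (1 - q))" for k
  proof -
    have "T (2 ^ k) \<le> T 1 + N * 2 powr \<rho> * (\<Sum>i<k. q ^ i)"
    proof (induction k)
      case (Suc k)
      then show ?case
        using step[of k] by (simp add: algebra_simps)
    qed simp
    also have "(\<Sum>i<k. q ^ i) \<le> 1 / (1 - q)"
    proof -
      have "(\<Sum>i<k. q ^ i) = (1 - q ^ k) / (1 - q)"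
        using q by (subst sum_gp_strict) auto
      also have "\<dots> \<le> 1 / (1 - q)"
        using q by (intro divide_right_mono) auto
      finally show ?thesis .
    qed
    finally show ?thesis
      using N by (simp add: mult_left_mono)
  qed
  moreover have "\<exists>k. r \<le> 2 ^ k" for r :: real
    using real_arch_pow[of 2 r] by (auto intro: less_imp_le)
  ultimately have "T r \<le> T 1 + N * 2 powr \<rho> * (1 / (1 - q))" for r
    using T_mono order_trans by metis
  moreover have "T 1 + N * 2 powr \<rho> * (1 / (1 - q)) \<ge> 0"
    using N q by (auto simp: T_def intro!: add_nonneg_nonneg sum_nonneg mult_nonneg_nonneg)
  ultimately show ?thesis
    using that unfolding T_def by blast
qed

text \<open>On the disk of radius \<open>r\<close> the cofactor is \<open>exp L\<close> with
  \<open>L 0 = 0\<close>, and the real part of \<open>L\<close> is of size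
  \<open>r powr \<rho>\<close>. Borel-Caratheodory makes \<open>L\<close> of size
  \<open>r powr (\<rho> - 1)\<close> on the unit disk, and Cauchy's inequalities there compare
  coefficients.\<close>

lemma zero_prod_tendsto:
  assumes bound: "\<And>z. norm (eval_fps g z) \<le> exp (C * norm z powr \<rho>)" and "C \<ge> 0" and \<rho>: "0 < \<rho>" "\<rho> < 1"
  shows "((\<lambda>r. fps_nth (zero_prod g r) n) \<longlongrightarrow> fps_nth g n) at_top"
proof -
  define e where "e r = 2 * (C * (3 * r) powr \<rho> + 1) / (r - 1)" for r
  define D where "D = (\<Sum>i\<le>n. norm (fps_nth g i))"
  have "\<forall>\<^sub>F r in at_top. norm (fps_nth (zero_prod g r) n - fps_nth g n) \<le> D * (exp (e r) - 1)"
    using eventually_gt_at_top[of 1]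
  proof eventually_elim
    case (elim r)
    obtain h where h: "h holomorphic_on UNIV" "h 0 = 1" "\<And>z. norm z \<le> r \<Longrightarrow> h z \<noteq> 0"
      "\<And>z. eval_fps g z = (\<Prod>b\<in>zeros_in g r. (1 - z / b) ^ mult_at g b) * h z"
      "\<And>z. norm z \<le> 3 * r \<Longrightarrow> 2 ^ (\<Sum>b\<in>zeros_in g r. mult_at g b) * norm (h z) \<le> exp (C * (3 * r) powr \<rho>)"
      using zero_prod_factor[OF bound, of r] elim by auto
    have h_le: "norm (h z) \<le> exp (C * (3 * r) powr \<rho>)" if "norm z \<le> r" for z
    proof -
      have "1 * norm (h z) \<le> 2 ^ (\<Sum>b\<in>zeros_in g r. mult_at g b) * norm (h z)"
        by (intro mult_right_mono one_le_power) auto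
      also have "\<dots> \<le> exp (C * (3 * r) powr \<rho>)"
        using that elim by (intro h(5)) simp
      finally show ?thesis
        by simp
    qed
    obtain L0 where L0: "L0 holomorphic_on ball 0 r" "\<And>z. z \<in> ball 0 r \<Longrightarrow> h z = exp (L0 z)"
      using contractible_imp_holomorphic_log[of h "ball 0 r"] h(1,3) convex_imp_contractible[of "ball 0 r"]
      by (metis convex_ball holomorphic_on_subset subset_UNIV less_imp_le mem_ball_0)
    define L where "L z = L0 z - L0 0" for z
    have L: "L holomorphic_on ball 0 r" "L 0 = 0"
      unfolding L_def using L0 by (auto intro!: holomorphic_intros)
    have h_eq: "h z = exp (L z)" if "norm z < r" for z
      using that L0(2)[of z] L0(2)[of 0] h(2) elim by (simp add: L_def exp_diff)
    \<comment> \<open>The summand 1 provides the strict inequality required by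
      \<open>Borel_Caratheodory\<close>.\<close>
    have "Re (L z) < C * (3 * r) powr \<rho> + 1" if "norm z < r" for z
    proof -
      have "exp (Re (L z)) \<le> exp (C * (3 * r) powr \<rho>)"
        using h_le[of z] that by (simp add: h_eq)
      then show ?thesis
        by simp
    qed
    note BC = Borel_Caratheodory[OF L this]
    have L_le: "norm (L z) \<le> e r" if "norm z \<le> 1" for z
    proof -
      have "norm (L z) \<le> 2 * (C * (3 * r) powr \<rho> + 1) * norm z / (r - norm z)"
        using that elim by (intro BC) auto
      also have "\<dots> \<le> 2 * (C * (3 * r) powr \<rho> + 1) * 1 / (r - 1)"
        using that elim \<open>C \<ge> 0\<close> by (intro frac_le mult_left_mono) auto
      finally show ?thesis
        by (simp add: e_def)
    qed
    \<comment> \<open>The inverse of the cofactor, so that the finite product equals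
      \<open>g\<close> times \<open>k\<close> near the origin.\<close>
    define k where "k z = exp (- L z)" for z
    have hol_k: "k holomorphic_on ball 0 r"
      unfolding k_def using L by (intro holomorphic_intros)
    then have "k analytic_on {0}"
      using elim unfolding analytic_at by (intro exI[of _ "ball 0 r"]) auto
    then have K: "k has_fps_expansion fps_expansion k 0"
      using analytic_at_imp_has_fps_expansion_0 by blast
    define K where "K = fps_expansion k 0"
    have ex: "(\<lambda>z. eval_fps g z * k z) has_fps_expansion g * K"
      unfolding K_def by (intro fps_expansion_intros entire_eval_fps K rad)
    have "eval_fps g z * k z = (\<Prod>b\<in>zeros_in g r. (1 - z / b) ^ mult_at g b)" if "norm z < r" for z
      using h_eq[OF that] by (simp add: h(4) k_def exp_minus)
    then have ev: "\<forall>\<^sub>F z in nhds 0. eval_fps g z * k z = (\<Prod>b\<in>zeros_in g r. (1 - z / b) ^ mult_at g b)"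
      using elim by (intro eventually_mono[OF eventually_nhds_in_open[of "ball 0 r"]]) auto
    have eq: "zero_prod g r = g * K"
      using zero_prod_expansion has_fps_expansion_cong[THEN iffD1, OF ev refl ex]
      by (rule fps_expansion_unique_complex)
    have K_le: "norm (fps_nth (K - 1) i) \<le> exp (e r) - 1" for i
    proof -
      have "norm (fps_nth (K - 1) i) \<le> (exp (e r) - 1) / 1 ^ i"
      proof (rule fps_nth_bound)
        show "(\<lambda>z. k z - 1) has_fps_expansion K - 1"
          unfolding K_def by (intro fps_expansion_intros K)
        show "(\<lambda>z. k z - 1) holomorphic_on cball 0 1"
          using elim by (intro holomorphic_intros holomorphic_on_subset[OF hol_k]) auto
        fix z :: complex assume "norm z = 1"
        have "norm (k z - 1) \<le> exp (norm (L z)) - 1"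
          using norm_exp_minus_1_le[of "- L z"] by (simp add: k_def)
        also have "\<dots> \<le> exp (e r) - 1"
          using L_le[of z] \<open>norm z = 1\<close> by simp
        finally show "norm (k z - 1) \<le> exp (e r) - 1" .
      qed simp
      then show ?thesis
        by simp
    qed
    have "fps_nth (zero_prod g r) n - fps_nth g n = fps_nth (g * (K - 1)) n"
      by (simp add: eq right_diff_distrib)
    also have "norm \<dots> \<le> (\<Sum>i\<le>n. norm (fps_nth g i * fps_nth (K - 1) (n - i)))"
      unfolding fps_mult_nth atLeast0AtMost by (rule norm_sum)
    also have "\<dots> \<le> (\<Sum>i\<le>n. norm (fps_nth g i) * (exp (e r) - 1))"
      unfolding norm_mult by (intro sum_mono mult_left_mono K_le) auto
    finally show ?case
      by (simp add: D_def sum_distrib_right)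
  qed
  moreover have "((\<lambda>r. D * (exp (e r) - 1)) \<longlongrightarrow> 0) at_top"
  proof -
    have "(e \<longlongrightarrow> 0) at_top"
      unfolding e_def using \<rho> by real_asymp
    then have "((\<lambda>r. D * (exp (e r) - 1)) \<longlongrightarrow> D * (exp 0 - 1)) at_top"
      by (intro tendsto_intros)
    then show ?thesis
      by simp
  qed
  ultimately have "((\<lambda>r. fps_nth (zero_prod g r) n - fps_nth g n) \<longlongrightarrow> 0) at_top"
    by (rule Lim_null_comparison)
  then show ?thesis
    by (simp add: LIM_zero_iff)
qed

end

section \<open>The e\~ne product of entire functions of order less than 1\<close>

context
  fixes f :: "complex fps"
  assumes rad: "fps_conv_radius f = \<infinity>" and f0: "fps_nth f 0 = 1"
begin

lemma eval_fps_eventually_nonzero: "\<forall>\<^sub>F w in at z. eval_fps f w \<noteq> 0"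
  by (rule entire_eventually_nonzero[OF entire_eval_fps(1)[OF rad], of 0]) (simp add: eval_fps_at_0 f0)

lemma zorder_eval_fps_nonneg: "zorder (eval_fps f) z \<ge> 0"
  using zorder_ge_0[OF entire_eval_fps(2)[OF rad]] eval_fps_eventually_nonzero
  by (metis at_neq_bot eventually_frequently)

lemma zorder_eval_fps_eq_0_iff: "zorder (eval_fps f) z = 0 \<longleftrightarrow> eval_fps f z \<noteq> 0"
  using zorder_eq_0_iff[OF entire_eval_fps(2)[OF rad]] eval_fps_eventually_nonzero
  by (metis at_neq_bot eventually_frequently)

end

text \<open>For the zeros up to a given modulus this is \<open>f \<star> zero_prod g r\<close>. The
  index set is arbitrary so that the tail over larger zeros is an instance too.\<close>

definition scaled_prod :: "complex fps \<Rightarrow> complex fps \<Rightarrow> complex set \<Rightarrow> complex fps" where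
  "scaled_prod f g Z = (\<Prod>b\<in>Z. (f oo (fps_const (1 / b) * fps_X)) ^ mult_at g b)"

lemma ene_zero_prod:
  assumes "fps_nth f 0 = 1"
  shows "f \<star> zero_prod g r = scaled_prod f g (zeros_in g r)"
  using assms
  by (simp add: zero_prod_def scaled_prod_def ene_prod_right ene_power_right ene_linear_right fps_nth_power_0)

lemma scaled_prod_nth_0: "fps_nth f 0 = 1 \<Longrightarrow> fps_nth (scaled_prod f g Z) 0 = 1"
  by (simp add: scaled_prod_def fps_nth_prod_0 fps_nth_power_0)

lemma
  assumes "fps_conv_radius f = \<infinity>"
  shows scaled_prod_conv_radius: "fps_conv_radius (scaled_prod f g Z) = \<infinity>"
    and eval_scaled_prod: "eval_fps (scaled_prod f g Z) z = (\<Prod>b\<in>Z. eval_fps f (z / b) ^ mult_at g b)"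
proof -
  let ?G = "\<lambda>z. \<Prod>b\<in>Z. eval_fps f (1 / b * z) ^ mult_at g b"
  have "(eval_fps f \<circ> (\<lambda>z. 1 / b * z)) has_fps_expansion (f oo (fps_const (1 / b) * fps_X))" for b
    by (intro has_fps_expansion_compose entire_eval_fps assms fps_expansion_intros) simp
  then have exp: "?G has_fps_expansion scaled_prod f g Z"
    unfolding scaled_prod_def by (intro fps_expansion_intros) (simp add: o_def)
  have "(eval_fps f \<circ> (\<lambda>z. 1 / b * z)) holomorphic_on A" for b A
    by (intro holomorphic_on_compose entire_eval_fps assms holomorphic_intros)
  then have hol: "?G holomorphic_on A" for A
    by (intro holomorphic_intros) (simp add: o_def)
  have "fps_conv_radius (scaled_prod f g Z) \<ge> \<infinity>"
    using exp hol by (rule holomorphic_on_imp_fps_conv_radius_ge)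
  then show "fps_conv_radius (scaled_prod f g Z) = \<infinity>"
    by simp
  have "eval_fps (scaled_prod f g Z) z = ?G z"
    by (rule has_fps_expansion_imp_eval_fps_eq[OF exp _ hol, of _ "norm z + 1"]) simp
  then show "eval_fps (scaled_prod f g Z) z = (\<Prod>b\<in>Z. eval_fps f (z / b) ^ mult_at g b)"
    by simp
qed

lemma zorder_scaled_prod:
  assumes f: "fps_conv_radius f = \<infinity>" "fps_nth f 0 = 1" and Z: "finite Z" "0 \<notin> Z"
  shows "zorder (eval_fps (scaled_prod f g Z)) \<xi> = (\<Sum>b\<in>Z. int (mult_at g b) * zorder (eval_fps f) (\<xi> / b))"
proof -
  have an: "(\<lambda>z. eval_fps f (1 / b * z)) analytic_on A" for b A
  proof -
    have "(eval_fps f \<circ> (\<lambda>z. 1 / b * z)) holomorphic_on UNIV"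
      by (intro holomorphic_on_compose entire_eval_fps f holomorphic_intros)
    then show ?thesis
      by (intro entire_imp_analytic) (simp add: o_def)
  qed
  have nz: "\<forall>\<^sub>F z in at \<xi>. eval_fps f (1 / b * z) \<noteq> 0" for b
    using an[of b UNIV] f(2)
    by (intro entire_eventually_nonzero[of "\<lambda>z. eval_fps f (1 / b * z)" 0])
      (auto simp: eval_fps_at_0 intro: analytic_imp_holomorphic)
  have "zorder (\<lambda>z. \<Prod>b\<in>Z. eval_fps f (1 / b * z) ^ mult_at g b) \<xi> =
      (\<Sum>b\<in>Z. zorder (\<lambda>z. eval_fps f (1 / b * z) ^ mult_at g b) \<xi>)"
  proof (rule zorder_prod_analytic)
    show "\<forall>\<^sub>F z in at \<xi>. (\<Prod>b\<in>Z. eval_fps f (1 / b * z) ^ mult_at g b) \<noteq> 0"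
      using Z(1) eventually_ball_finite[OF Z(1), of "\<lambda>z b. eval_fps f (1 / b * z) \<noteq> 0" "at \<xi>"] nz
      by (auto elim!: eventually_mono)
  qed (intro analytic_intros an)
  also have "\<dots> = (\<Sum>b\<in>Z. int (mult_at g b) * zorder (eval_fps f) (\<xi> / b))"
  proof (rule sum.cong[OF refl])
    fix b assume "b \<in> Z"
    then have "1 / b \<noteq> 0"
      using Z by auto
    have "zorder (\<lambda>z. eval_fps f (1 / b * z) ^ mult_at g b) \<xi> =
        int (mult_at g b) * zorder (\<lambda>z. eval_fps f (1 / b * z)) \<xi>"
      by (intro zorder_power analytic_on_imp_meromorphic_on an eventually_frequently nz) simp
    also have "zorder (\<lambda>z. eval_fps f (1 / b * z)) \<xi> = zorder (eval_fps f) (1 / b * \<xi>)"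
      by (intro Laurent_Convergence.zorder_scale entire_eval_fps eval_fps_eventually_nonzero f \<open>1 / b \<noteq> 0\<close>)
    finally show "zorder (\<lambda>z. eval_fps f (1 / b * z) ^ mult_at g b) \<xi> =
        int (mult_at g b) * zorder (eval_fps f) (\<xi> / b)"
      by simp
  qed
  moreover have "eval_fps (scaled_prod f g Z) = (\<lambda>z. \<Prod>b\<in>Z. eval_fps f (1 / b * z) ^ mult_at g b)"
    by (simp add: eval_scaled_prod[OF f(1)] fun_eq_iff)
  ultimately show ?thesis
    by metis
qed

context
  fixes f g :: "complex fps"
  assumes f: "entire_of_order_lt_1 f" "fps_nth f 0 = 1"
    and g: "entire_of_order_lt_1 g" "fps_nth g 0 = 1"
begin

lemma conv_radius_eq_infinity: "fps_conv_radius f = \<infinity>" "fps_conv_radius g = \<infinity>"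
  using f g by (auto simp: entire_of_order_lt_1_def)

text \<open>The exponent is taken strictly above one valid for \<open>g\<close>, so that the sum
  over its zeros is bounded, and large enough for the growth of \<open>f\<close>.\<close>

lemma growth_data:
  obtains \<rho> C B where "0 < \<rho>" "\<rho> < 1" "C \<ge> 0" "B \<ge> 0"
    "\<And>z. norm (eval_fps f z) \<le> exp (C * norm z powr \<rho>)"
    "\<And>r. (\<Sum>b\<in>zeros_in g r. real (mult_at g b) * norm b powr (- \<rho>)) \<le> B"
proof -
  obtain \<rho>f where \<rho>f: "0 < \<rho>f" "\<rho>f < 1"
    "\<And>\<rho>. \<rho>f \<le> \<rho> \<Longrightarrow> \<rho> < 1 \<Longrightarrow> \<exists>C\<ge>0. \<forall>z. norm (eval_fps f z) \<le> exp (C * norm z powr \<rho>)"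
    using entire_of_order_lt_1_growth[OF f] by blast
  obtain \<rho>g where \<rho>g: "0 < \<rho>g" "\<rho>g < 1"
    "\<And>\<rho>. \<rho>g \<le> \<rho> \<Longrightarrow> \<rho> < 1 \<Longrightarrow> \<exists>C\<ge>0. \<forall>z. norm (eval_fps g z) \<le> exp (C * norm z powr \<rho>)"
    using entire_of_order_lt_1_growth[OF g] by blast
  obtain \<rho> where \<rho>: "max \<rho>f \<rho>g < \<rho>" "\<rho> < 1"
    using dense[of "max \<rho>f \<rho>g" 1] \<rho>f \<rho>g by auto
  obtain C where C: "C \<ge> 0" "\<And>z. norm (eval_fps f z) \<le> exp (C * norm z powr \<rho>)"
    using \<rho>f(3)[of \<rho>] \<rho> by auto
  obtain D where D: "D \<ge> 0" "\<And>z. norm (eval_fps g z) \<le> exp (D * norm z powr \<rho>g)"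
    using \<rho>g(3)[of \<rho>g] \<rho>g by auto
  obtain B where "B \<ge> 0" "\<And>r. (\<Sum>b\<in>zeros_in g r. real (mult_at g b) * norm b powr (- \<rho>)) \<le> B"
    using sum_zeros_bounded[OF conv_radius_eq_infinity(2) g(2) D(2) D(1), of \<rho>] \<rho> \<rho>f by auto
  then show ?thesis
    using that[of \<rho> C B] C \<rho> \<rho>f by auto
qed

lemma scaled_prod_tendsto:
  "((\<lambda>r. fps_nth (scaled_prod f g (zeros_in g r)) n) \<longlongrightarrow> fps_nth (f \<star> g) n) at_top"
proof -
  obtain \<rho> where \<rho>: "0 < \<rho>" "\<rho> < 1"
    "\<And>\<rho>'. \<rho> \<le> \<rho>' \<Longrightarrow> \<rho>' < 1 \<Longrightarrow> \<exists>C\<ge>0. \<forall>z. norm (eval_fps g z) \<le> exp (C * norm z powr \<rho>')"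
    using entire_of_order_lt_1_growth[OF g] by blast
  then obtain C where C: "C \<ge> 0" "\<And>z. norm (eval_fps g z) \<le> exp (C * norm z powr \<rho>)"
    using \<rho>(3)[of \<rho>] by auto
  have "((\<lambda>r. fps_nth (f \<star> zero_prod g r) n) \<longlongrightarrow> fps_nth (f \<star> g) n) at_top"
    by (intro tendsto_ene_right zero_prod_tendsto[OF conv_radius_eq_infinity(2) g(2) C(2) C(1)] \<rho>)
  then show ?thesis
    by (simp add: ene_zero_prod f)
qed

theorem entire_of_order_lt_1_ene: "entire_of_order_lt_1 (f \<star> g)"
proof -
  obtain \<rho> C B where *: "0 < \<rho>" "\<rho> < 1" "C \<ge> 0" "B \<ge> 0"
    "\<And>z. norm (eval_fps f z) \<le> exp (C * norm z powr \<rho>)"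
    "\<And>r. (\<Sum>b\<in>zeros_in g r. real (mult_at g b) * norm b powr (- \<rho>)) \<le> B"
    using growth_data by blast
  have G: "norm (eval_fps (scaled_prod f g (zeros_in g r)) z) \<le> exp (C * B * norm z powr \<rho>)" for r z
  proof -
    have "norm (eval_fps (scaled_prod f g (zeros_in g r)) z) \<le>
        (\<Prod>b\<in>zeros_in g r. exp (C * norm (z / b) powr \<rho>) ^ mult_at g b)"
      unfolding eval_scaled_prod[OF conv_radius_eq_infinity(1)] prod_norm [symmetric] norm_power
      by (intro prod_mono conjI power_mono *) auto
    also have "\<dots> = exp (\<Sum>b\<in>zeros_in g r. real (mult_at g b) * (C * norm (z / b) powr \<rho>))"
      by (simp add: exp_sum finite_zeros_in conv_radius_eq_infinity g exp_of_nat_mult)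
    also have "(\<Sum>b\<in>zeros_in g r. real (mult_at g b) * (C * norm (z / b) powr \<rho>)) =
        C * norm z powr \<rho> * (\<Sum>b\<in>zeros_in g r. real (mult_at g b) * norm b powr (- \<rho>))"
    proof -
      have "norm (z / b) powr \<rho> = norm z powr \<rho> * norm b powr (- \<rho>)" for b
        by (simp add: norm_divide powr_divide powr_minus_divide)
      then show ?thesis
        by (simp add: sum_distrib_left mult_ac)
    qed
    also have "\<dots> \<le> C * norm z powr \<rho> * B"
      using * by (intro mult_left_mono) auto
    finally show ?thesis
      by (simp add: mult_ac)
  qed
  \<comment> \<open>The bound \<open>G\<close> is uniform in \<open>r\<close>, but convergence is
    known only for coefficients; hence Cauchy's inequalities are applied before the limit.\<close>
  have coeff: "norm (fps_nth (f \<star> g) n) \<le> exp (C * B * s powr \<rho>) / s ^ n" if "s > 0" for n s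
  proof (rule tendsto_upperbound[OF tendsto_norm[OF scaled_prod_tendsto]])
    have "norm (fps_nth (scaled_prod f g (zeros_in g r)) n) \<le> exp (C * B * s powr \<rho>) / s ^ n" for r
    proof (rule fps_nth_bound)
      fix z :: complex assume "norm z = s"
      then show "norm (eval_fps (scaled_prod f g (zeros_in g r)) z) \<le> exp (C * B * s powr \<rho>)"
        using G[of r z] by simp
    qed (intro entire_eval_fps scaled_prod_conv_radius conv_radius_eq_infinity that)+
    then show "\<forall>\<^sub>F r in at_top. norm (fps_nth (scaled_prod f g (zeros_in g r)) n) \<le> exp (C * B * s powr \<rho>) / s ^ n"
      by simp
  qed simp
  note entire = coeff_bound_imp_entire[OF ene_nth_0 coeff]
  have "norm (eval_fps (f \<star> g) z) \<le> 2 * exp ((C * B * 2 powr \<rho>) * norm z powr \<rho>)" for z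
    using entire(2)[of z] by (simp add: powr_mult mult_ac)
  then show ?thesis
    using * by (intro growth_imp_entire_of_order_lt_1[OF entire(1)]) auto
qed

text \<open>A factor \<open>f (z / b)\<close> differs from 1 by at most \<open>K s / |b|\<close>.
  For \<open>|b| > r\<close> the inverse of \<open>|b|\<close> is at most
  \<open>r powr (\<rho> - 1)\<close> times \<open>|b| powr (- \<rho>)\<close>, which is summable
  over the zeros. The estimate is uniform in \<open>R\<close>.\<close>

lemma norm_eval_tail_minus_1_le:
  assumes K: "K \<ge> 0" "\<And>z. norm z \<le> 1 \<Longrightarrow> norm (eval_fps f z - 1) \<le> K * norm z"
    and B: "\<And>r. (\<Sum>b\<in>zeros_in g r. real (mult_at g b) * norm b powr (- \<rho>)) \<le> B"
    and "\<rho> < 1" "0 < s" "s \<le> r" "norm z = s"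
  shows "norm (eval_fps (scaled_prod f g (zeros_in g R - zeros_in g r)) z - 1) \<le> exp (K * s * B * r powr (\<rho> - 1)) - 1"
proof -
  let ?Z = "zeros_in g R - zeros_in g r"
  have le: "norm (eval_fps f (z / b) ^ mult_at g b - 1) \<le>
      exp (K * s * r powr (\<rho> - 1) * (real (mult_at g b) * norm b powr (- \<rho>))) - 1" if "b \<in> ?Z" for b
  proof -
    have b: "norm b > r"
      using that by (auto simp: zeros_in_def)
    then have nb: "norm b > 0" "norm (z / b) \<le> 1"
      using assms by (auto simp: norm_divide divide_simps)
    have "norm (eval_fps f (z / b) - 1) \<le> K * (s * norm b powr (-1))"
      using K(2)[OF nb(2)] nb \<open>norm z = s\<close> by (simp add: norm_divide powr_minus_divide)
    also have "norm b powr (-1) = norm b powr (\<rho> - 1) * norm b powr (- \<rho>)"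
      by (simp flip: powr_add)
    also have "\<dots> \<le> r powr (\<rho> - 1) * norm b powr (- \<rho>)"
      using b assms by (intro mult_right_mono powr_mono2') auto
    finally have "norm (eval_fps f (z / b) - 1) \<le> K * s * r powr (\<rho> - 1) * norm b powr (- \<rho>)"
      using K assms by (simp add: mult_left_mono mult.assoc)
    then have "real (mult_at g b) * norm (eval_fps f (z / b) - 1) \<le>
        real (mult_at g b) * (K * s * r powr (\<rho> - 1) * norm b powr (- \<rho>))"
      by (rule mult_left_mono) simp
    also have "\<dots> = K * s * r powr (\<rho> - 1) * (real (mult_at g b) * norm b powr (- \<rho>))"
      by (simp add: mult_ac)
    finally have "exp (real (mult_at g b) * norm (eval_fps f (z / b) - 1)) - 1 \<le>
        exp (K * s * r powr (\<rho> - 1) * (real (mult_at g b) * norm b powr (- \<rho>))) - 1"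
      by simp
    with norm_power_minus_1_le show ?thesis
      by (rule order_trans)
  qed
  have "norm (eval_fps (scaled_prod f g ?Z) z - 1) \<le>
      exp (\<Sum>b\<in>?Z. K * s * r powr (\<rho> - 1) * (real (mult_at g b) * norm b powr (- \<rho>))) - 1"
    unfolding eval_scaled_prod[OF conv_radius_eq_infinity(1)] by (rule norm_prod_minus_1_le[OF le])
  also have "(\<Sum>b\<in>?Z. K * s * r powr (\<rho> - 1) * (real (mult_at g b) * norm b powr (- \<rho>))) =
      K * s * r powr (\<rho> - 1) * (\<Sum>b\<in>?Z. real (mult_at g b) * norm b powr (- \<rho>))"
    by (simp add: sum_distrib_left)
  also have "\<dots> \<le> K * s * r powr (\<rho> - 1) * B"
  proof (rule mult_left_mono)
    have "(\<Sum>b\<in>?Z. real (mult_at g b) * norm b powr (- \<rho>)) \<le>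
        (\<Sum>b\<in>zeros_in g R. real (mult_at g b) * norm b powr (- \<rho>))"
      by (intro sum_mono2 finite_zeros_in conv_radius_eq_infinity g) auto
    then show "(\<Sum>b\<in>?Z. real (mult_at g b) * norm b powr (- \<rho>)) \<le> B"
      using B[of R] by simp
  qed (use K assms in simp)
  finally show ?thesis
    by (simp add: mult_ac)
qed

text \<open>The cofactor \<open>k\<close> is the coefficientwise limit of the tails. Their bound on
  the circle of radius \<open>2 |\<xi>|\<close> bounds the coefficients of \<open>k - 1\<close>, so
  \<open>k\<close> converges beyond \<open>\<xi>\<close> and stays within \<open>1 / 2\<close> of 1
  there.\<close>

lemma ene_eq_scaled_prod_mult:
  assumes "\<xi> \<noteq> 0" and bound: "\<And>R z. R \<ge> r \<Longrightarrow> norm z = 2 * norm \<xi> \<Longrightarrow>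
    norm (eval_fps (scaled_prod f g (zeros_in g R - zeros_in g r)) z - 1) \<le> 1 / 2"
  obtains k where "f \<star> g = scaled_prod f g (zeros_in g r) * k" "fps_conv_radius k > norm \<xi>" "eval_fps k \<xi> \<noteq> 0"
proof -
  let ?G = "scaled_prod f g (zeros_in g r)" and ?s = "2 * norm \<xi>"
  define k where "k = (f \<star> g) * inverse ?G"
  have G0: "fps_nth ?G 0 = 1"
    by (rule scaled_prod_nth_0[OF f(2)])
  then have eq: "f \<star> g = ?G * k"
    unfolding k_def using inverse_mult_eq_1'[of ?G] by (simp add: mult.left_commute)
  have k0: "fps_nth k 0 = 1"
    using G0 by (simp add: k_def)
  have quot: "scaled_prod f g (zeros_in g R) * inverse ?G = scaled_prod f g (zeros_in g R - zeros_in g r)"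
    if "R \<ge> r" for R
  proof -
    have "zeros_in g r \<subseteq> zeros_in g R"
      using that by (auto simp: zeros_in_def)
    then have "scaled_prod f g (zeros_in g R) = scaled_prod f g (zeros_in g R - zeros_in g r) * ?G"
      unfolding scaled_prod_def by (intro prod.subset_diff finite_zeros_in conv_radius_eq_infinity g)
    then show ?thesis
      using inverse_mult_eq_1'[of ?G] G0 by (simp add: mult.assoc)
  qed
  have k_le: "norm (fps_nth (k - 1) n) \<le> 1 / 2 / ?s ^ n" for n
  proof (rule tendsto_upperbound)
    have "((\<lambda>R. fps_nth (scaled_prod f g (zeros_in g R) * inverse ?G - 1) n) \<longlongrightarrow> fps_nth (k - 1) n) at_top"
      unfolding k_def fps_sub_nth fps_mult_nth by (intro tendsto_intros scaled_prod_tendsto)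
    then show "((\<lambda>R. norm (fps_nth (scaled_prod f g (zeros_in g R) * inverse ?G - 1) n)) \<longlongrightarrow>
        norm (fps_nth (k - 1) n)) at_top"
      by (rule tendsto_norm)
    show "\<forall>\<^sub>F R in at_top. norm (fps_nth (scaled_prod f g (zeros_in g R) * inverse ?G - 1) n) \<le> 1 / 2 / ?s ^ n"
      using eventually_ge_at_top[of r]
    proof eventually_elim
      case (elim R)
      let ?H = "scaled_prod f g (zeros_in g R - zeros_in g r)"
      have "norm (fps_nth (?H - 1) n) \<le> 1 / 2 / ?s ^ n"
      proof (rule fps_nth_bound)
        show "(\<lambda>z. eval_fps ?H z - 1) has_fps_expansion ?H - 1"
          by (intro fps_expansion_intros entire_eval_fps scaled_prod_conv_radius conv_radius_eq_infinity)
        show "(\<lambda>z. eval_fps ?H z - 1) holomorphic_on cball 0 ?s"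
          by (intro holomorphic_intros entire_eval_fps scaled_prod_conv_radius conv_radius_eq_infinity)
      qed (use bound elim \<open>\<xi> \<noteq> 0\<close> in auto)
      then show ?case
        by (simp add: quot[OF elim])
    qed
  qed simp
  have le: "norm (fps_nth (k - 1) n * z ^ n) \<le> 1 / 2 * c ^ n" if "norm z = c * ?s" for n z c
  proof -
    have "norm (fps_nth (k - 1) n * z ^ n) \<le> 1 / 2 / ?s ^ n * norm z ^ n"
      unfolding norm_mult norm_power by (intro mult_right_mono k_le) simp
    also have "\<dots> = 1 / 2 * c ^ n"
      using \<open>\<xi> \<noteq> 0\<close> unfolding that power_mult_distrib by simp
    finally show ?thesis .
  qed
  have "summable (\<lambda>n. fps_nth (k - 1) n * (of_real (3 / 2) * \<xi>) ^ n)"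
  proof (rule summable_norm_cancel, rule summable_comparison_test)
    show "\<exists>N. \<forall>n\<ge>N. norm (norm (fps_nth (k - 1) n * (of_real (3 / 2) * \<xi>) ^ n)) \<le> 1 / 2 * (3 / 4) ^ n"
      using le[of "of_real (3 / 2) * \<xi>" "3 / 4"] by (auto simp: norm_mult)
  qed (simp add: summable_geometric)
  then have "fps_conv_radius (k - 1) \<ge> norm (of_real (3 / 2) * \<xi>)"
    unfolding fps_conv_radius_def by (rule conv_radius_geI)
  moreover have "norm (of_real (3 / 2) * \<xi>) > norm \<xi>"
    using \<open>\<xi> \<noteq> 0\<close> by (simp add: norm_mult)
  ultimately have rad': "fps_conv_radius (k - 1) > norm \<xi>"
    by (meson ereal_less(2) less_ereal.simps(1) less_le_trans)
  moreover have "fps_conv_radius (k - 1) \<le> fps_conv_radius k"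
    using fps_conv_radius_add[of "k - 1" 1] by simp
  ultimately have rad: "fps_conv_radius k > norm \<xi>"
    by (rule less_le_trans)
  have eval_k: "eval_fps k \<xi> - 1 = eval_fps (k - 1) \<xi>"
    using rad by (subst eval_fps_diff) auto
  have "norm (eval_fps (k - 1) \<xi>) \<le> 1 / 2"
  proof -
    have geo: "(\<lambda>n. 1 / 2 * (1 / 2) ^ n) sums (1 / 2 * (2 :: real))"
      using geometric_sums[of "1 / 2 :: real"] by (intro sums_mult) simp
    \<comment> \<open>The constant term of \<open>k - 1\<close> is 0; starting at index 1 lowers the
      geometric bound from 1 to \<open>1 / 2\<close>.\<close>
    have geo': "(\<lambda>n. 1 / 2 * (1 / 2) ^ Suc n) sums (1 / 2 :: real)"
      using geo by (subst sums_Suc_iff) simp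
    have "(\<lambda>n. fps_nth (k - 1) n * \<xi> ^ n) sums eval_fps (k - 1) \<xi>"
      using rad' by (rule sums_eval_fps)
    then have "(\<lambda>n. fps_nth (k - 1) (Suc n) * \<xi> ^ Suc n) sums eval_fps (k - 1) \<xi>"
      by (subst sums_Suc_iff) (simp add: k0)
    then show ?thesis
      by (rule norm_sums_le[OF _ geo']) (rule le, simp)
  qed
  moreover have "eval_fps (k - 1) \<xi> = - 1" if "eval_fps k \<xi> = 0"
    using eval_k that by simp
  ultimately have "eval_fps k \<xi> \<noteq> 0"
    by auto
  then show ?thesis
    using that[OF eq rad] by simp
qed

text \<open>A pair with product \<open>\<xi>\<close> is indexed by its second member
  \<open>b\<close>. Allowing any finite \<open>T\<close> containing \<open>S\<close> lets several
  such formulas be summed over a common index set.\<close>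

lemma zorder_ene:
  assumes "\<xi> \<noteq> 0"
  defines "S \<equiv> {b. b \<noteq> 0 \<and> zorder (eval_fps f) (\<xi> / b) \<noteq> 0 \<and> zorder (eval_fps g) b \<noteq> 0}"
  shows "finite S"
    and "\<lbrakk>finite T; S \<subseteq> T; 0 \<notin> T\<rbrakk> \<Longrightarrow>
      zorder (eval_fps (f \<star> g)) \<xi> = (\<Sum>b\<in>T. zorder (eval_fps f) (\<xi> / b) * zorder (eval_fps g) b)"
proof -
  obtain \<rho> C B where *: "0 < \<rho>" "\<rho> < 1" "C \<ge> 0" "B \<ge> 0"
    "\<And>z. norm (eval_fps f z) \<le> exp (C * norm z powr \<rho>)"
    "\<And>r. (\<Sum>b\<in>zeros_in g r. real (mult_at g b) * norm b powr (- \<rho>)) \<le> B"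
    using growth_data by blast
  obtain K where K: "K \<ge> 0" "\<And>z. norm z \<le> 1 \<Longrightarrow> norm (eval_fps f z - 1) \<le> K * norm z"
    using eval_fps_linear_bound[OF conv_radius_eq_infinity(1) f(2), of 1] by blast
  let ?s = "2 * norm \<xi>"
  \<comment> \<open>The radius \<open>r\<close> is chosen so large that the tail differs from 1 by
    at most \<open>exp (ln (3 / 2)) - 1 = 1 / 2\<close>, and that \<open>f\<close> has no zero at
    \<open>\<xi> / b\<close> when \<open>|b| > r\<close>.\<close>
  have "((\<lambda>r. K * ?s * B * r powr (\<rho> - 1)) \<longlongrightarrow> K * ?s * B * 0) at_top"
    using * by (intro tendsto_intros tendsto_neg_powr filterlim_ident) auto
  then have "\<forall>\<^sub>F r in at_top. K * ?s * B * r powr (\<rho> - 1) < ln (3 / 2)"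
    by (intro order_tendstoD(2)) auto
  moreover have "\<forall>\<^sub>F r in at_top. r > max ?s (K * ?s)"
    by (rule eventually_gt_at_top)
  ultimately have "\<forall>\<^sub>F r in at_top. K * ?s * B * r powr (\<rho> - 1) < ln (3 / 2) \<and> r > max ?s (K * ?s)"
    by (rule eventually_conj)
  then obtain r where "K * ?s * B * r powr (\<rho> - 1) < ln (3 / 2) \<and> r > max ?s (K * ?s)"
    unfolding eventually_at_top_linorder by blast
  then have r: "K * ?s * B * r powr (\<rho> - 1) < ln (3 / 2)" "r > ?s" "r > K * ?s"
    by simp_all
  have "r > 0"
    using r(2) norm_ge_zero[of \<xi>] by linarith
  have "norm (eval_fps (scaled_prod f g (zeros_in g R - zeros_in g r)) z - 1) \<le> 1 / 2" if "norm z = ?s" for R z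
  proof -
    have "norm (eval_fps (scaled_prod f g (zeros_in g R - zeros_in g r)) z - 1) \<le>
        exp (K * ?s * B * r powr (\<rho> - 1)) - 1"
      using r \<open>\<xi> \<noteq> 0\<close> by (intro norm_eval_tail_minus_1_le[OF K *(6) *(2) _ _ that]) auto
    also have "\<dots> \<le> exp (ln (3 / 2)) - 1"
      using exp_less_mono[OF r(1)] by linarith
    finally show ?thesis
      by simp
  qed
  then obtain k where k: "f \<star> g = scaled_prod f g (zeros_in g r) * k" "fps_conv_radius k > norm \<xi>" "eval_fps k \<xi> \<noteq> 0"
    using ene_eq_scaled_prod_mult[OF \<open>\<xi> \<noteq> 0\<close>, of r] by blast
  let ?G = "scaled_prod f g (zeros_in g r)"
  have an_k: "eval_fps k analytic_on {\<xi>}"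
    using k(2) by (intro analytic_on_eval_fps) (auto simp: in_eball_iff)
  have G: "fps_conv_radius ?G = \<infinity>" "fps_nth ?G 0 = 1"
    by (intro scaled_prod_conv_radius conv_radius_eq_infinity scaled_prod_nth_0 f)+
  obtain t where t: "norm \<xi> < t" "ereal t < fps_conv_radius k"
    using ereal_dense2[OF k(2)] by auto
  have ev: "\<forall>\<^sub>F z in nhds \<xi>. eval_fps (f \<star> g) z = eval_fps ?G z * eval_fps k z"
  proof (rule eventually_mono[OF eventually_nhds_in_open[of "ball 0 t"]])
    fix z :: complex assume "z \<in> ball 0 t"
    then have "ereal (norm z) < fps_conv_radius k"
      using t by (auto intro: less_trans[of _ "ereal t"])
    then show "eval_fps (f \<star> g) z = eval_fps ?G z * eval_fps k z"
      unfolding k(1) by (intro eval_fps_mult) (auto simp: G)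
  qed (use t in auto)
  have "\<forall>\<^sub>F z in nhds \<xi>. eval_fps k z \<noteq> 0"
    using analytic_at_imp_isCont[OF an_k] k(3) by (intro tendsto_imp_eventually_ne) (auto simp: isCont_def tendsto_at_iff_tendsto_nhds)
  then have nz: "\<forall>\<^sub>F z in at \<xi>. eval_fps ?G z * eval_fps k z \<noteq> 0"
    using eval_fps_eventually_nonzero[OF G, of \<xi>]
    by (auto simp: eventually_at_filter elim: eventually_elim2)
  have "zorder (eval_fps (f \<star> g)) \<xi> = zorder (\<lambda>z. eval_fps ?G z * eval_fps k z) \<xi>"
    using ev by (intro zorder_cong) (auto simp: eventually_at_filter elim: eventually_mono)
  also have "\<dots> = zorder (eval_fps ?G) \<xi> + zorder (eval_fps k) \<xi>"
    using nz by (intro zorder_times_analytic entire_eval_fps G an_k)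
  also have "zorder (eval_fps k) \<xi> = 0"
    by (rule zorder_eq_0I[OF an_k k(3)])
  also have "zorder (eval_fps ?G) \<xi> = (\<Sum>b\<in>zeros_in g r. int (mult_at g b) * zorder (eval_fps f) (\<xi> / b))"
    by (intro zorder_scaled_prod conv_radius_eq_infinity f finite_zeros_in zero_notin_zeros_in g)
  also have "\<dots> = (\<Sum>b\<in>zeros_in g r. zorder (eval_fps f) (\<xi> / b) * zorder (eval_fps g) b)"
    using zorder_eval_fps_nonneg[OF conv_radius_eq_infinity(2) g(2)] by (simp add: mult_at_def mult.commute)
  finally have sum: "zorder (eval_fps (f \<star> g)) \<xi> = (\<Sum>b\<in>zeros_in g r. zorder (eval_fps f) (\<xi> / b) * zorder (eval_fps g) b)"
    by simp
  \<comment> \<open>A zero of \<open>f\<close> at \<open>\<xi> / b\<close> with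
    \<open>|b| > r\<close> would give \<open>1 \<le> K |\<xi> / b|\<close>, against the choice of
    \<open>r\<close>.\<close>
  have S_sub: "S \<subseteq> zeros_in g r"
  proof
    fix b assume "b \<in> S"
    then have b: "b \<noteq> 0" "eval_fps f (\<xi> / b) = 0" "eval_fps g b = 0"
      by (auto simp: S_def zorder_eval_fps_eq_0_iff[OF conv_radius_eq_infinity(1) f(2)] zorder_eval_fps_eq_0_iff[OF conv_radius_eq_infinity(2) g(2)])
    have "norm b \<le> r"
    proof (rule ccontr)
      assume "\<not> norm b \<le> r"
      then have nb: "norm b > r"
        by simp
      then have "norm (\<xi> / b) \<le> 1"
        using r(2) \<open>r > 0\<close> by (simp add: norm_divide divide_simps)
      then have "1 \<le> K * norm (\<xi> / b)"
        using K(2)[of "\<xi> / b"] b(2) by simp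
      then have "norm b \<le> K * norm \<xi>"
        using nb \<open>r > 0\<close> by (simp add: norm_divide divide_simps split: if_splits)
      also have "\<dots> \<le> K * ?s"
        using K by (intro mult_left_mono) auto
      finally show False
        using r nb by simp
    qed
    then show "b \<in> zeros_in g r"
      using b by (simp add: zeros_in_def)
  qed
  then show "finite S"
    by (rule finite_subset) (intro finite_zeros_in conv_radius_eq_infinity g)
  have sum_S: "(\<Sum>b\<in>A. zorder (eval_fps f) (\<xi> / b) * zorder (eval_fps g) b) =
      (\<Sum>b\<in>S. zorder (eval_fps f) (\<xi> / b) * zorder (eval_fps g) b)" if "finite A" "S \<subseteq> A" "0 \<notin> A" for A
    using that by (intro sum.mono_neutral_right) (auto simp: S_def)
  show "zorder (eval_fps (f \<star> g)) \<xi> = (\<Sum>b\<in>T. zorder (eval_fps f) (\<xi> / b) * zorder (eval_fps g) b)"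
    if "finite T" "S \<subseteq> T" "0 \<notin> T"
    using sum sum_S[OF that] sum_S[OF finite_zeros_in[OF conv_radius_eq_infinity(2) g(2)] S_sub zero_notin_zeros_in[OF conv_radius_eq_infinity(2) g(2)]]
    by simp
qed

end

section \<open>Quotients\<close>

lemma entire_of_order_lt_1_mult:
  assumes f: "entire_of_order_lt_1 f" "fps_nth f 0 = 1" and g: "entire_of_order_lt_1 g" "fps_nth g 0 = 1"
  shows "entire_of_order_lt_1 (f * g)"
proof -
  have rad: "fps_conv_radius f = \<infinity>" "fps_conv_radius g = \<infinity>"
    using f g by (auto simp: entire_of_order_lt_1_def)
  obtain \<rho>f where \<rho>f: "0 < \<rho>f" "\<rho>f < 1"
    "\<And>\<rho>. \<rho>f \<le> \<rho> \<Longrightarrow> \<rho> < 1 \<Longrightarrow> \<exists>C\<ge>0. \<forall>z. norm (eval_fps f z) \<le> exp (C * norm z powr \<rho>)"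
    using entire_of_order_lt_1_growth[OF f] by blast
  obtain \<rho>g where \<rho>g: "0 < \<rho>g" "\<rho>g < 1"
    "\<And>\<rho>. \<rho>g \<le> \<rho> \<Longrightarrow> \<rho> < 1 \<Longrightarrow> \<exists>C\<ge>0. \<forall>z. norm (eval_fps g z) \<le> exp (C * norm z powr \<rho>)"
    using entire_of_order_lt_1_growth[OF g] by blast
  define \<rho> where "\<rho> = max \<rho>f \<rho>g"
  have \<rho>: "0 < \<rho>" "\<rho> < 1" "\<rho>f \<le> \<rho>" "\<rho>g \<le> \<rho>"
    using \<rho>f \<rho>g by (auto simp: \<rho>_def)
  obtain C where C: "\<And>z. norm (eval_fps f z) \<le> exp (C * norm z powr \<rho>)"
    using \<rho>f(3)[of \<rho>] \<rho> by auto
  obtain D where D: "\<And>z. norm (eval_fps g z) \<le> exp (D * norm z powr \<rho>)"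
    using \<rho>g(3)[of \<rho>] \<rho> by auto
  show ?thesis
  proof (rule growth_imp_entire_of_order_lt_1)
    show "fps_conv_radius (f * g) = \<infinity>"
      using fps_conv_radius_mult[of f g] rad by simp
    fix z
    have "norm (eval_fps (f * g) z) = norm (eval_fps f z) * norm (eval_fps g z)"
      using rad by (simp add: eval_fps_mult norm_mult)
    also have "\<dots> \<le> exp (C * norm z powr \<rho>) * exp (D * norm z powr \<rho>)"
      by (intro mult_mono C D) auto
    finally show "norm (eval_fps (f * g) z) \<le> 1 * exp ((C + D) * norm z powr \<rho>)"
      by (simp add: exp_add [symmetric] algebra_simps)
  qed (use \<rho> f g in auto)
qed

text \<open>Under \<open>psum\<close> the identity becomes the expansion of
  \<open>(p1 - q1) (p2 - q2)\<close>, taken coefficientwise.\<close>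

lemma ene_quotient:
  assumes const: "fps_nth f1 0 = 1" "fps_nth f2 0 = 1" "fps_nth q1 0 = 1" "fps_nth q2 0 = 1"
    "fps_nth p1 0 = 1" "fps_nth p2 0 = 1"
    and "f1 * q1 = p1" "f2 * q2 = p2"
  shows "(f1 \<star> f2) * ((p1 \<star> q2) * (q1 \<star> p2)) = (p1 \<star> p2) * (q1 \<star> q2)"
proof (rule psum_inject)
  have "psum p1 = psum f1 + psum q1" "psum p2 = psum f2 + psum q2"
    using assms psum_mult by metis+
  then show "psum ((f1 \<star> f2) * ((p1 \<star> q2) * (q1 \<star> p2))) = psum ((p1 \<star> p2) * (q1 \<star> q2))"
    by (intro fps_ext) (simp add: psum_mult psum_ene const algebra_simps)
qed simp_all

text \<open>The quotient formula may fail on a sparse set, possibly at the origin. It holds in a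
  punctured neighbourhood of 0, and the value at 0 is supplied by the constant terms.\<close>

lemma fps_quotient_mult:
  fixes f p q :: "complex fps"
  assumes F: "F has_fps_expansion f" and rad: "fps_conv_radius p = \<infinity>" "fps_conv_radius q = \<infinity>"
    and const: "fps_nth f 0 = 1" "fps_nth p 0 = 1" "fps_nth q 0 = 1"
    and quot: "\<forall>\<^sub>\<approx>z. F z = eval_fps p z / eval_fps q z"
  shows "f * q = p"
proof -
  have "\<forall>\<^sub>F z in at 0. F z = eval_fps p z / eval_fps q z"
    using quot by (rule eventually_cosparse_imp_eventually_at) simp
  then have "\<forall>\<^sub>F z in at 0. F z * eval_fps q z = eval_fps p z"
    using eval_fps_eventually_nonzero[OF rad(2) const(3), of 0] by eventually_elim simp
  moreover have "F 0 * eval_fps q 0 = eval_fps p 0"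
    using has_fps_expansion_imp_0_eq_fps_nth_0[OF F] const by (simp add: eval_fps_at_0)
  ultimately have ev: "\<forall>\<^sub>F z in nhds 0. F z * eval_fps q z = eval_fps p z"
    by (auto simp: eventually_nhds_conv_at)
  have "(\<lambda>z. F z * eval_fps q z) has_fps_expansion f * q"
    by (intro fps_expansion_intros F entire_eval_fps rad)
  from has_fps_expansion_cong[THEN iffD1, OF ev refl this] show ?thesis
    using entire_eval_fps(4)[OF rad(1)] by (rule fps_expansion_unique_complex)
qed

lemma zorder_quotient:
  assumes rad: "fps_conv_radius p = \<infinity>" "fps_conv_radius q = \<infinity>" and const: "fps_nth p 0 = 1" "fps_nth q 0 = 1"
    and quot: "\<forall>\<^sub>\<approx>z. F z = eval_fps p z / eval_fps q z"
  shows "zorder F z = zorder (eval_fps p) z - zorder (eval_fps q) z"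
proof -
  have "\<forall>\<^sub>F w in at z. F w = eval_fps p w / eval_fps q w"
    using quot by (rule eventually_cosparse_imp_eventually_at) simp
  then have "zorder F z = zorder (\<lambda>w. eval_fps p w / eval_fps q w) z"
    by (rule zorder_cong) simp
  also have "\<dots> = zorder (eval_fps p) z - zorder (eval_fps q) z"
    by (intro zorder_divide analytic_on_imp_meromorphic_on entire_eval_fps rad eventually_frequently
        eval_fps_eventually_nonzero const) auto
  finally show ?thesis .
qed

theorem theorem5p2:
  fixes A :: "complex set"
    and f1 f2 P1 Q1 P2 Q2 :: "complex fps"
    and F1 F2 :: "complex \<Rightarrow> complex"
  assumes A: "complex_subring A"
    and f1: "f1 \<in> one_series A" and f2: "f2 \<in> one_series A"
    and F1: "F1 meromorphic_on UNIV" "F1 has_fps_expansion f1"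
    and F2: "F2 meromorphic_on UNIV" "F2 has_fps_expansion f2"
    and P1: "P1 \<in> one_series A" "entire_of_order_lt_1 P1"
    and Q1: "Q1 \<in> one_series A" "entire_of_order_lt_1 Q1"
    and P2: "P2 \<in> one_series A" "entire_of_order_lt_1 P2"
    and Q2: "Q2 \<in> one_series A" "entire_of_order_lt_1 Q2"
    and quot1: "\<forall>\<^sub>\<approx>z. F1 z = eval_fps P1 z / eval_fps Q1 z"
    and quot2: "\<forall>\<^sub>\<approx>z. F2 z = eval_fps P2 z / eval_fps Q2 z"
  shows "entire_of_order_lt_1 (P1 \<star> P2) \<and> entire_of_order_lt_1 (Q1 \<star> Q2) \<and>
         entire_of_order_lt_1 (P1 \<star> Q2) \<and> entire_of_order_lt_1 (Q1 \<star> P2) \<and>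
         entire_of_order_lt_1 ((P1 \<star> P2) * (Q1 \<star> Q2)) \<and>
         entire_of_order_lt_1 ((P1 \<star> Q2) * (Q1 \<star> P2)) \<and>
         f1 \<star> f2 = ((P1 \<star> P2) * (Q1 \<star> Q2)) / ((P1 \<star> Q2) * (Q1 \<star> P2)) \<and>
         (\<exists>F. F meromorphic_on UNIV \<and> F has_fps_expansion (f1 \<star> f2) \<and>
              (\<forall>\<^sub>\<approx>z. F z = (eval_fps (P1 \<star> P2) z * eval_fps (Q1 \<star> Q2) z) /
                            (eval_fps (P1 \<star> Q2) z * eval_fps (Q1 \<star> P2) z)) \<and>
              (\<forall>\<xi>. \<xi> \<noteq> 0 \<longrightarrow>
                 (let S = {(\<alpha>, \<beta>). \<alpha> \<noteq> 0 \<and> \<beta> \<noteq> 0 \<and> \<alpha> * \<beta> = \<xi> \<and> zorder F1 \<alpha> * zorder F2 \<beta> \<noteq> 0}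
                  in finite S \<and> zorder F \<xi> = (\<Sum>(\<alpha>, \<beta>)\<in>S. zorder F1 \<alpha> * zorder F2 \<beta>))))"
proof -
  have const: "fps_nth f1 0 = 1" "fps_nth f2 0 = 1" "fps_nth P1 0 = 1" "fps_nth Q1 0 = 1"
    "fps_nth P2 0 = 1" "fps_nth Q2 0 = 1"
    using f1 f2 P1 Q1 P2 Q2 by (auto simp: one_series_def)
  note ent = P1(2) Q1(2) P2(2) Q2(2)
  have rad: "fps_conv_radius P1 = \<infinity>" "fps_conv_radius Q1 = \<infinity>" "fps_conv_radius P2 = \<infinity>" "fps_conv_radius Q2 = \<infinity>"
    using ent by (auto simp: entire_of_order_lt_1_def)
  have PP: "entire_of_order_lt_1 (P1 \<star> P2)" and QQ: "entire_of_order_lt_1 (Q1 \<star> Q2)"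
    and PQ: "entire_of_order_lt_1 (P1 \<star> Q2)" and QP: "entire_of_order_lt_1 (Q1 \<star> P2)"
    by (intro entire_of_order_lt_1_ene ent const)+
  have num: "entire_of_order_lt_1 ((P1 \<star> P2) * (Q1 \<star> Q2))" and den: "entire_of_order_lt_1 ((P1 \<star> Q2) * (Q1 \<star> P2))"
    by (intro entire_of_order_lt_1_mult PP QQ PQ QP ene_nth_0)+
  have rad': "fps_conv_radius (P1 \<star> P2) = \<infinity>" "fps_conv_radius (Q1 \<star> Q2) = \<infinity>"
    "fps_conv_radius (P1 \<star> Q2) = \<infinity>" "fps_conv_radius (Q1 \<star> P2) = \<infinity>"
    using PP QQ PQ QP by (auto simp: entire_of_order_lt_1_def)
  have "(f1 \<star> f2) * ((P1 \<star> Q2) * (Q1 \<star> P2)) = (P1 \<star> P2) * (Q1 \<star> Q2)"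
    using fps_quotient_mult[OF F1(2) rad(1,2) const(1,3,4) quot1]
      fps_quotient_mult[OF F2(2) rad(3,4) const(2,5,6) quot2]
    by (intro ene_quotient const)
  moreover have "(P1 \<star> Q2) * (Q1 \<star> P2) \<noteq> 0"
    by (metis ene_nth_0 fps_mult_nth_0 fps_zero_nth mult_1 zero_neq_one)
  ultimately have eq: "f1 \<star> f2 = ((P1 \<star> P2) * (Q1 \<star> Q2)) / ((P1 \<star> Q2) * (Q1 \<star> P2))"
    by (metis nonzero_mult_div_cancel_right)
  \<comment> \<open>At zeros of the denominator the value is the default 0; this is harmless, since
    meromorphy and \<open>zorder\<close> depend only on punctured neighbourhoods.\<close>
  define F where "F z = (eval_fps (P1 \<star> P2) z * eval_fps (Q1 \<star> Q2) z) /
      (eval_fps (P1 \<star> Q2) z * eval_fps (Q1 \<star> P2) z)" for z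
  have mero: "F meromorphic_on UNIV"
    unfolding F_def by (intro meromorphic_intros analytic_on_imp_meromorphic_on entire_eval_fps rad')
  have expansion: "F has_fps_expansion f1 \<star> f2"
    unfolding F_def eq
    by (intro has_fps_expansion_divide' fps_expansion_intros entire_eval_fps rad') simp
  have divisor: "let S = {(\<alpha>, \<beta>). \<alpha> \<noteq> 0 \<and> \<beta> \<noteq> 0 \<and> \<alpha> * \<beta> = \<xi> \<and> zorder F1 \<alpha> * zorder F2 \<beta> \<noteq> 0}
      in finite S \<and> zorder F \<xi> = (\<Sum>(\<alpha>, \<beta>)\<in>S. zorder F1 \<alpha> * zorder F2 \<beta>)" if "\<xi> \<noteq> 0" for \<xi>
  proof -
    define S where "S = {(\<alpha>, \<beta>). \<alpha> \<noteq> 0 \<and> \<beta> \<noteq> 0 \<and> \<alpha> * \<beta> = \<xi> \<and> zorder F1 \<alpha> * zorder F2 \<beta> \<noteq> 0}"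
    let ?S = "\<lambda>f g. {b. b \<noteq> 0 \<and> zorder (eval_fps f) (\<xi> / b) \<noteq> 0 \<and> zorder (eval_fps g) b \<noteq> 0}"
    \<comment> \<open>A common finite index set for the four divisor formulas.\<close>
    define T where "T = ?S P1 P2 \<union> ?S Q1 Q2 \<union> ?S P1 Q2 \<union> ?S Q1 P2"
    have T: "finite T" "0 \<notin> T"
      unfolding T_def by (auto intro!: zorder_ene(1) ent const that)
    have sub: "?S P1 P2 \<subseteq> T" "?S Q1 Q2 \<subseteq> T" "?S P1 Q2 \<subseteq> T" "?S Q1 P2 \<subseteq> T"
      by (auto simp: T_def)
    have ene: "zorder (eval_fps (P1 \<star> P2)) \<xi> = (\<Sum>b\<in>T. zorder (eval_fps P1) (\<xi> / b) * zorder (eval_fps P2) b)"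
      "zorder (eval_fps (Q1 \<star> Q2)) \<xi> = (\<Sum>b\<in>T. zorder (eval_fps Q1) (\<xi> / b) * zorder (eval_fps Q2) b)"
      "zorder (eval_fps (P1 \<star> Q2)) \<xi> = (\<Sum>b\<in>T. zorder (eval_fps P1) (\<xi> / b) * zorder (eval_fps Q2) b)"
      "zorder (eval_fps (Q1 \<star> P2)) \<xi> = (\<Sum>b\<in>T. zorder (eval_fps Q1) (\<xi> / b) * zorder (eval_fps P2) b)"
      by (intro zorder_ene(2) ent const that T sub)+
    note zF1 = zorder_quotient[OF rad(1,2) const(3,4) quot1]
    note zF2 = zorder_quotient[OF rad(3,4) const(5,6) quot2]
    have nz: "\<forall>\<^sub>F w in at \<xi>. eval_fps f w * eval_fps g w \<noteq> 0"
      if "fps_conv_radius f = \<infinity>" "fps_nth f 0 = 1" "fps_conv_radius g = \<infinity>" "fps_nth g 0 = 1" for f g :: "complex fps"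
      using eval_fps_eventually_nonzero[OF that(1,2), of \<xi>] eval_fps_eventually_nonzero[OF that(3,4), of \<xi>]
      by eventually_elim simp
    have "zorder F \<xi> = zorder (\<lambda>z. eval_fps (P1 \<star> P2) z * eval_fps (Q1 \<star> Q2) z) \<xi> -
        zorder (\<lambda>z. eval_fps (P1 \<star> Q2) z * eval_fps (Q1 \<star> P2) z) \<xi>"
      unfolding F_def
      by (intro zorder_divide meromorphic_intros analytic_on_imp_meromorphic_on entire_eval_fps rad'
          eventually_frequently nz ene_nth_0) auto
    also have "\<dots> = (zorder (eval_fps (P1 \<star> P2)) \<xi> + zorder (eval_fps (Q1 \<star> Q2)) \<xi>) -
        (zorder (eval_fps (P1 \<star> Q2)) \<xi> + zorder (eval_fps (Q1 \<star> P2)) \<xi>)"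
      by (intro arg_cong2[where f = minus] zorder_times_analytic entire_eval_fps rad' nz ene_nth_0)
    \<comment> \<open>The four sums recombine into the product of the differences of orders of
      numerators and denominators.\<close>
    also have "\<dots> = (\<Sum>b\<in>T. zorder F1 (\<xi> / b) * zorder F2 b)"
      unfolding ene by (simp add: zF1 zF2 algebra_simps sum.distrib sum_subtractf)
    also have "\<dots> = (\<Sum>b\<in>{b \<in> T. zorder F1 (\<xi> / b) * zorder F2 b \<noteq> 0}. zorder F1 (\<xi> / b) * zorder F2 b)"
      using T by (intro sum.mono_neutral_right) auto
    also have "\<dots> = (\<Sum>(\<alpha>, \<beta>)\<in>(\<lambda>b. (\<xi> / b, b)) ` {b \<in> T. zorder F1 (\<xi> / b) * zorder F2 b \<noteq> 0}.
        zorder F1 \<alpha> * zorder F2 \<beta>)"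
      by (subst sum.reindex) (auto simp: inj_on_def)
    also have S_eq: "(\<lambda>b. (\<xi> / b, b)) ` {b \<in> T. zorder F1 (\<xi> / b) * zorder F2 b \<noteq> 0} = S"
    proof (intro equalityI subsetI)
      fix p assume "p \<in> S"
      then obtain \<alpha> \<beta> where p: "p = (\<alpha>, \<beta>)" "\<beta> \<noteq> 0" "\<alpha> * \<beta> = \<xi>" "zorder F1 \<alpha> * zorder F2 \<beta> \<noteq> 0"
        by (auto simp: S_def)
      then have "\<alpha> = \<xi> / \<beta>"
        by auto
      \<comment> \<open>A nonzero product of these differences forces one of its four expanded terms
        to be nonzero.\<close>
      moreover from this have "\<beta> \<in> T"
        using p by (auto simp: T_def zF1 zF2)
      ultimately show "p \<in> (\<lambda>b. (\<xi> / b, b)) ` {b \<in> T. zorder F1 (\<xi> / b) * zorder F2 b \<noteq> 0}"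
        using p by auto
    qed (use T that in \<open>auto simp: S_def\<close>)
    finally have "zorder F \<xi> = (\<Sum>(\<alpha>, \<beta>)\<in>S. zorder F1 \<alpha> * zorder F2 \<beta>)" .
    moreover have "finite S"
      using T by (simp flip: S_eq)
    ultimately show ?thesis
      by (simp add: S_def Let_def)
  qed
  have "\<exists>F. F meromorphic_on UNIV \<and> F has_fps_expansion (f1 \<star> f2) \<and>
      (\<forall>\<^sub>\<approx>z. F z = (eval_fps (P1 \<star> P2) z * eval_fps (Q1 \<star> Q2) z) /
                    (eval_fps (P1 \<star> Q2) z * eval_fps (Q1 \<star> P2) z)) \<and>
      (\<forall>\<xi>. \<xi> \<noteq> 0 \<longrightarrow>
         (let S = {(\<alpha>, \<beta>). \<alpha> \<noteq> 0 \<and> \<beta> \<noteq> 0 \<and> \<alpha> * \<beta> = \<xi> \<and> zorder F1 \<alpha> * zorder F2 \<beta> \<noteq> 0}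
          in finite S \<and> zorder F \<xi> = (\<Sum>(\<alpha>, \<beta>)\<in>S. zorder F1 \<alpha> * zorder F2 \<beta>)))"
  proof (intro exI[of _ F] conjI allI impI)
    show "\<forall>\<^sub>\<approx>z. F z = (eval_fps (P1 \<star> P2) z * eval_fps (Q1 \<star> Q2) z) /
        (eval_fps (P1 \<star> Q2) z * eval_fps (Q1 \<star> P2) z)"
      by (simp add: F_def)
  qed (fact mero expansion divisor)+
  with PP QQ PQ QP num den eq show ?thesis
    by blast
qed

end
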